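(* Let $G$ be a countable, infinite group. Then the group $\mathrm{Aut}(M(G),G)$ of automorphisms of the universal minimal flow has cardinality $2^{\mathfrak{c}}$. In particular, $M(G)$ is not proximal.
   Context: The universal minimal flow $M(G)$ is the (unique up to isomorphism) minimal $G$-flow admitting a $G$-equivariant continuous surjection onto every minimal $G$-flow. $\mathrm{Aut}(Y,G)$ is the group of homeomorphisms of $Y$ commuting with the $G$-action. $\mathfrak{c}$ is the cardinality of the continuum. A flow is proximal if for every two points $x_1,x_2$ there exist $y$ and a net $(g_i)$ with $g_ix_1\to y$ and $g_ix_2\to y$. *)

theory Defs
  imports "HOL-Analysis.Analysis" "HOL-Library.Equipollence" "HOL-Algebra.Group"
begin

definition gflow :: "('g, 'm) monoid_scheme \<Rightarrow> 'x topology \<Rightarrow> ('g \<Rightarrow> 'x \<Rightarrow> 'x) \<Rightarrow> bool" where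
  "gflow G X a \<longleftrightarrow> group G \<and> topspace X \<noteq> {} \<and> compact_space X \<and> Hausdorff_space X \<and>
     (\<forall>g\<in>carrier G. continuous_map X X (a g)) \<and>
     (\<forall>x\<in>topspace X. a \<one>\<^bsub>G\<^esub> x = x) \<and>
     (\<forall>g\<in>carrier G. \<forall>h\<in>carrier G. \<forall>x\<in>topspace X. a (g \<otimes>\<^bsub>G\<^esub> h) x = a g (a h x))"

definition minimal_gflow :: "('g, 'm) monoid_scheme \<Rightarrow> 'x topology \<Rightarrow> ('g \<Rightarrow> 'x \<Rightarrow> 'x) \<Rightarrow> bool" where
  "minimal_gflow G X a \<longleftrightarrow> gflow G X a \<and>
     (\<forall>S. closedin X S \<and> S \<noteq> {} \<and> (\<forall>g\<in>carrier G. a g ` S \<subseteq> S) \<longrightarrow> S = topspace X)"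

definition gflow_factor_map ::
  "('g, 'm) monoid_scheme \<Rightarrow> 'x topology \<Rightarrow> ('g \<Rightarrow> 'x \<Rightarrow> 'x) \<Rightarrow> 'y topology \<Rightarrow> ('g \<Rightarrow> 'y \<Rightarrow> 'y) \<Rightarrow> ('x \<Rightarrow> 'y) \<Rightarrow> bool" where
  "gflow_factor_map G X a Y b f \<longleftrightarrow> continuous_map X Y f \<and> f ` topspace X = topspace Y \<and>
     (\<forall>g\<in>carrier G. \<forall>x\<in>topspace X. f (a g x) = b g (f x))"

text \<open>Universal minimal flow: a minimal flow that factors onto every minimal flow.
 Every minimal flow of a countable group G is a factor of the Stone-Cech compactification
 (ultrafilters on G, a subset of 'g set set) and so has cardinality at most 2^c; hence
 every minimal flow is isomorphic to one living on the type 'g set set, and quantifying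
 over minimal flows on that type is equivalent to quantifying over all minimal flows.\<close>
definition universal_minimal_flow :: "('g, 'm) monoid_scheme \<Rightarrow> 'x topology \<Rightarrow> ('g \<Rightarrow> 'x \<Rightarrow> 'x) \<Rightarrow> bool" where
  "universal_minimal_flow G X a \<longleftrightarrow> minimal_gflow G X a \<and>
     (\<forall>(Y :: 'g set set topology) b. minimal_gflow G Y b \<longrightarrow> (\<exists>f. gflow_factor_map G X a Y b f))"

text \<open>Aut(X,G): homeomorphisms of X commuting with the action (normalised to the identity
 outside the carrier, so that distinct automorphisms are distinct HOL functions).\<close>
definition flow_aut :: "('g, 'm) monoid_scheme \<Rightarrow> 'x topology \<Rightarrow> ('g \<Rightarrow> 'x \<Rightarrow> 'x) \<Rightarrow> ('x \<Rightarrow> 'x) set" where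
  "flow_aut G X a = {f. homeomorphic_map X X f \<and>
     (\<forall>g\<in>carrier G. \<forall>x\<in>topspace X. f (a g x) = a g (f x)) \<and>
     (\<forall>x. x \<notin> topspace X \<longrightarrow> f x = x)}"

text \<open>Proximality; nets are rendered as (proper) filters on the group.\<close>
definition proximal_flow :: "('g, 'm) monoid_scheme \<Rightarrow> 'x topology \<Rightarrow> ('g \<Rightarrow> 'x \<Rightarrow> 'x) \<Rightarrow> bool" where
  "proximal_flow G X a \<longleftrightarrow> (\<forall>x1\<in>topspace X. \<forall>x2\<in>topspace X. \<exists>y F.
     F \<noteq> bot \<and> eventually (\<lambda>g. g \<in> carrier G) F \<and>
     limitin X (\<lambda>g. a g x1) y F \<and> limitin X (\<lambda>g. a g x2) y F)"

end

theory Submission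
  imports Defs
begin

text \<open>
  Suppose some minimal flow \<open>Z\<close> of \<open>G\<close> admits a free action, by automorphisms, of a group \<open>K\<close> of
  cardinality \<open>2^c\<close>. If \<open>f : M(G) \<rightarrow> Z\<close> is a factor map and \<open>k \<in> K\<close>, then a minimal subset of
  \<open>{(x, y). f y = k (f x)}\<close> is a factor of \<open>M(G)\<close>, and since every endomorphism of \<open>M(G)\<close> is bijective
  (by the structure of minimal left ideals of the enveloping semigroup) it is the graph of an automorphism
  lifting \<open>k\<close>. Distinct \<open>k\<close> have distinct lifts, which gives the lower bound; the upper bound holds because an
  automorphism is determined by the image of one point and points are determined by families of subsets
  of \<open>G\<close>. A nontrivial automorphism \<open>\<phi>\<close> makes the pairs \<open>(x, \<phi> x)\<close> non-proximal.

  For \<open>Z\<close> take a minimal subshift of \<open>({0,1}^I)^G\<close>, with \<open>I\<close> of cardinality \<open>c\<close>, that is invariant under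
  all coordinate flips \<open>k \<in> {0,1}^I\<close>. It is the intersection of (the closures of) a decreasing sequence of
  flip-invariant, strongly irreducible sets of configurations, the \<open>m\<close>-th of which is refined by requiring every
  configuration to display, with bounded gaps, all patterns of the previous set on the ball of radius \<open>m\<close>.
\<close>

section \<open>Minimal flows\<close>

text \<open>Zorn's lemma for reverse inclusion, with compactness keeping the intersection of a chain
  nonempty. The predicate \<open>Q\<close> is abstract because the lemma serves minimal subflows as
  well as minimal closed subsemigroups.\<close>

lemma compact_minimal_closed_set:
  assumes comp: "compact_space X" and S0: "closedin X S0" "S0 \<noteq> {}" "Q S0"
    and Int: "\<And>\<C>. \<C> \<noteq> {} \<Longrightarrow> (\<And>S. S \<in> \<C> \<Longrightarrow> closedin X S \<and> Q S) \<Longrightarrow> Q (\<Inter>\<C>)"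
  obtains S where "S \<subseteq> S0" "closedin X S" "S \<noteq> {}" "Q S"
    "\<And>S'. S' \<subseteq> S \<Longrightarrow> closedin X S' \<Longrightarrow> S' \<noteq> {} \<Longrightarrow> Q S' \<Longrightarrow> S' = S"
proof -
  define A where "A = {S. S \<subseteq> S0 \<and> closedin X S \<and> S \<noteq> {} \<and> Q S}"
  have "\<exists>m\<in>A. \<forall>S\<in>A. m \<supseteq> S \<longrightarrow> S = m"
  proof (rule predicate_Zorn)
    show "partial_order_on A (relation_of (\<supseteq>) A)"
      by (auto simp: partial_order_on_def preorder_on_def relation_of_def refl_on_def trans_def antisym_def)
    fix C assume C: "C \<in> Chains (relation_of (\<supseteq>) A)"
    then have CA: "S \<in> A" if "S \<in> C" for S using that by (auto simp: Chains_def relation_of_def)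
    have lin: "S \<subseteq> S' \<or> S' \<subseteq> S" if "S \<in> C" "S' \<in> C" for S S'
      using C that by (auto simp: Chains_def relation_of_def)
    show "\<exists>u\<in>A. \<forall>S\<in>C. S \<supseteq> u"
    proof (cases "C = {}")
      case True
      then show ?thesis using S0 by (auto simp: A_def)
    next
      case False
      have "\<Inter>F \<noteq> {}" if F: "finite F" "F \<subseteq> C" for F
      proof (cases "F = {}")
        case False
        \<comment> \<open>A finite nonempty part of a chain has a least member, and that member lies
          inside the intersection.\<close>
        then obtain S where S: "S \<in> F" "\<And>S'. S' \<in> F \<Longrightarrow> S' \<subseteq> S \<Longrightarrow> S = S'"
          using finite_has_minimal[OF F(1)] by metis
        have "S \<subseteq> S'" if "S' \<in> F" for S'
          using lin[of S S'] S that F(2) by blast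
        with S(1) have "S \<in> F" "S \<subseteq> \<Inter>F" by auto
        then show ?thesis using CA[of S] F(2) by (auto simp: A_def)
      qed simp
      then have "\<Inter>C \<noteq> {}"
        using comp CA unfolding compact_space_fip by (simp add: A_def)
      moreover have "Q (\<Inter>C)" using Int[OF False] CA by (simp add: A_def)
      moreover have "closedin X (\<Inter>C)" using False CA by (intro closedin_Inter) (auto simp: A_def)
      moreover have "\<Inter>C \<subseteq> S0" using False CA by (auto simp: A_def)
      ultimately show ?thesis by (intro bexI[of _ "\<Inter>C"]) (auto simp: A_def)
    qed
  qed
  then obtain S where S: "S \<in> A" "\<And>S'. S' \<in> A \<Longrightarrow> S' \<subseteq> S \<Longrightarrow> S' = S" by blast
  show thesis
  proof (rule that[of S])
    fix S' assume "S' \<subseteq> S" "closedin X S'" "S' \<noteq> {}" "Q S'"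
    then show "S' = S" using S(1) by (intro S(2)) (auto simp: A_def)
  qed (use S(1) in \<open>auto simp: A_def\<close>)
qed

section \<open>Flow homomorphisms and subflows\<close>

definition flow_hom ::
  "('g, 'm) monoid_scheme \<Rightarrow> 'x topology \<Rightarrow> ('g \<Rightarrow> 'x \<Rightarrow> 'x) \<Rightarrow> 'y topology \<Rightarrow> ('g \<Rightarrow> 'y \<Rightarrow> 'y) \<Rightarrow> ('x \<Rightarrow> 'y) \<Rightarrow> bool"
  where "flow_hom G X a Y b f \<longleftrightarrow> continuous_map X Y f \<and>
    (\<forall>g\<in>carrier G. \<forall>x\<in>topspace X. f (a g x) = b g (f x))"

lemma flow_hom_compose:
  "flow_hom G X a Y b f \<Longrightarrow> flow_hom G Y b Z c h \<Longrightarrow> flow_hom G X a Z c (h \<circ> f)"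
  unfolding flow_hom_def using continuous_map_funspace[of X Y f]
  by (auto intro: continuous_map_compose simp: Pi_iff)

lemma gflow_point:
  assumes "gflow G X a" obtains x where "x \<in> topspace X"
  using assms unfolding gflow_def by blast

lemma gflow_closed:
  "gflow G X a \<Longrightarrow> g \<in> carrier G \<Longrightarrow> x \<in> topspace X \<Longrightarrow> a g x \<in> topspace X"
  unfolding gflow_def continuous_map_def by blast

lemma gflow_subflow:
  assumes "gflow G X a" "closedin X S" "S \<noteq> {}" "\<forall>g\<in>carrier G. a g ` S \<subseteq> S"
  shows "gflow G (subtopology X S) a"
proof -
  have sub: "S \<subseteq> topspace X" using assms(2) closedin_subset by blast
  have "compact_space (subtopology X S)"
    using assms(1,2) by (simp add: gflow_def closedin_compact_space compact_space_subtopology)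
  moreover have "continuous_map (subtopology X S) (subtopology X S) (a g)" if "g \<in> carrier G" for g
    using assms(1,4) that sub
    by (auto simp: gflow_def continuous_map_in_subtopology continuous_map_from_subtopology)
  ultimately show ?thesis
    using assms sub by (auto simp: gflow_def Hausdorff_space_subtopology)
qed

lemma minimal_subflow_exists:
  assumes flow: "gflow G X a" and S0: "closedin X S0" "S0 \<noteq> {}" "\<forall>g\<in>carrier G. a g ` S0 \<subseteq> S0"
  obtains S where "S \<subseteq> S0" "closedin X S" "minimal_gflow G (subtopology X S) a"
proof -
  obtain S where S: "S \<subseteq> S0" "closedin X S" "S \<noteq> {}" "\<forall>g\<in>carrier G. a g ` S \<subseteq> S"
    and min: "\<And>S'. S' \<subseteq> S \<Longrightarrow> closedin X S' \<Longrightarrow> S' \<noteq> {} \<Longrightarrow> \<forall>g\<in>carrier G. a g ` S' \<subseteq> S' \<Longrightarrow> S' = S"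
  proof (rule compact_minimal_closed_set[of X S0 "\<lambda>S. \<forall>g\<in>carrier G. a g ` S \<subseteq> S"])
    show "compact_space X" using flow by (simp add: gflow_def)
    show "\<forall>g\<in>carrier G. a g ` \<Inter>\<C> \<subseteq> \<Inter>\<C>"
      if "\<And>S. S \<in> \<C> \<Longrightarrow> closedin X S \<and> (\<forall>g\<in>carrier G. a g ` S \<subseteq> S)" for \<C>
      using that by blast
  qed (use S0 in auto)
  have "S \<subseteq> topspace X" using S(2) closedin_subset by blast
  moreover have "T = S" if "closedin (subtopology X S) T" "T \<noteq> {}" "\<forall>g\<in>carrier G. a g ` T \<subseteq> T" for T
    using that min closedin_trans_full[OF that(1) S(2)] closedin_imp_subset[OF that(1)] by blast
  ultimately have "minimal_gflow G (subtopology X S) a"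
    unfolding minimal_gflow_def using gflow_subflow[OF flow S(2,3,4)] by (auto simp: Int_absorb1)
  then show thesis using that S by blast
qed

lemma minimal_gflow_eqI:
  assumes "minimal_gflow G X a" "closedin X S" "S \<noteq> {}" "\<And>g x. g \<in> carrier G \<Longrightarrow> x \<in> S \<Longrightarrow> a g x \<in> S"
  shows "S = topspace X"
  using assms unfolding minimal_gflow_def by blast

text \<open>The image is compact, hence closed, and it is invariant. This is why
  \<open>flow_hom\<close>, unlike \<open>gflow_factor_map\<close>, omits surjectivity.\<close>

lemma flow_hom_image:
  assumes f: "flow_hom G X a Y b f" and X: "gflow G X a" and Y: "minimal_gflow G Y b"
  shows "f ` topspace X = topspace Y"
proof (rule minimal_gflow_eqI[OF Y])
  show "closedin Y (f ` topspace X)"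
    using continuous_imp_closed_map[of X Y f] f X Y
    by (auto simp: flow_hom_def gflow_def minimal_gflow_def closed_map_def)
  show "f ` topspace X \<noteq> {}" using X by (simp add: gflow_def)
  fix g y assume g: "g \<in> carrier G" and "y \<in> f ` topspace X"
  then obtain x where x: "x \<in> topspace X" "y = f x" by blast
  then have "b g y = f (a g x)" using f g by (simp add: flow_hom_def)
  then show "b g y \<in> f ` topspace X" using gflow_closed[OF X g x(1)] by blast
qed

text \<open>The set where two homomorphisms agree is invariant, and closed because the target is
  Hausdorff; minimality leaves only the empty set and the whole space.\<close>

lemma flow_hom_eqI:
  assumes f: "flow_hom G X a Y b f" and h: "flow_hom G X a Y b h" and X: "minimal_gflow G X a"
    and Y: "Hausdorff_space Y" and x0: "x0 \<in> topspace X" "f x0 = h x0" and x: "x \<in> topspace X"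
  shows "f x = h x"
proof -
  have "{x \<in> topspace X. f x = h x} = topspace X"
  proof (rule minimal_gflow_eqI[OF X])
    show "closedin X {x \<in> topspace X. f x = h x}"
      using f h Y by (intro closedin_continuous_maps_eq) (auto simp: flow_hom_def)
    show "{x \<in> topspace X. f x = h x} \<noteq> {}" using x0 by blast
    show "a g x \<in> {x \<in> topspace X. f x = h x}"
      if "g \<in> carrier G" "x \<in> {x \<in> topspace X. f x = h x}" for g x
      using that f h gflow_closed[of G X a g x] X by (auto simp: flow_hom_def minimal_gflow_def)
  qed
  then show ?thesis using x by blast
qed

section \<open>Dense orbits and the universal property\<close>

lemma minimal_orbit_dense:
  assumes Y: "minimal_gflow G Y b" and y: "y \<in> topspace Y"
  shows "Y closure_of ((\<lambda>g. b g y) ` carrier G) = topspace Y"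
proof (rule minimal_gflow_eqI[OF Y])
  have flow: "gflow G Y b" and G: "group G" using Y by (auto simp: minimal_gflow_def gflow_def)
  let ?O = "(\<lambda>g. b g y) ` carrier G"
  have O: "?O \<subseteq> topspace Y" using gflow_closed[OF flow _ y] by blast
  show "closedin Y (Y closure_of ?O)" by simp
  have "\<one>\<^bsub>G\<^esub> \<in> carrier G" using G by (simp add: group.is_monoid monoid.one_closed)
  then show "Y closure_of ?O \<noteq> {}" using closure_of_subset[OF O] by blast
  fix g x assume g: "g \<in> carrier G" and x: "x \<in> Y closure_of ?O"
  have "b g ` ?O \<subseteq> ?O"
  proof clarify
    fix h assume h: "h \<in> carrier G"
    then have "b g (b h y) = b (g \<otimes>\<^bsub>G\<^esub> h) y" using flow g y by (simp add: gflow_def)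
    moreover have "g \<otimes>\<^bsub>G\<^esub> h \<in> carrier G" using G g h by (simp add: group.is_monoid monoid.m_closed)
    ultimately show "b g (b h y) \<in> ?O" by blast
  qed
  then have "Y closure_of (b g ` ?O) \<subseteq> Y closure_of ?O" by (rule closure_of_mono)
  moreover have "b g ` (Y closure_of ?O) \<subseteq> Y closure_of (b g ` ?O)"
    using flow g by (intro continuous_map_image_closure_subset) (auto simp: gflow_def)
  ultimately show "b g x \<in> Y closure_of ?O" using x by blast
qed

text \<open>A point is determined by the sets of group elements whose orbit pieces accumulate at it.\<close>
lemma minimal_gflow_embeds:
  fixes G :: "('g, 'm) monoid_scheme"
  assumes Y: "minimal_gflow G Y b"
  obtains j :: "'y \<Rightarrow> 'g set set" where "inj_on j (topspace Y)" "j ` topspace Y \<subseteq> Pow (Pow (carrier G))"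
proof -
  have flow: "gflow G Y b" using Y by (simp add: minimal_gflow_def)
  then obtain y0 where y0: "y0 \<in> topspace Y" by (rule gflow_point)
  define j where "j y = {A. A \<subseteq> carrier G \<and> y \<in> Y closure_of ((\<lambda>g. b g y0) ` A)}" for y
  have "inj_on j (topspace Y)"
  proof (rule inj_onI, rule ccontr)
    fix x y assume xy: "x \<in> topspace Y" "y \<in> topspace Y" "j x = j y" "x \<noteq> y"
    have "Hausdorff_space Y" using flow by (simp add: gflow_def)
    with xy(1,2,4) obtain U V where UV: "openin Y U" "openin Y V" "x \<in> U" "y \<in> V" "disjnt U V"
      unfolding Hausdorff_space_def by metis
    \<comment> \<open>Density of the orbit of \<open>y0\<close> makes \<open>x\<close> a limit of
      the part of the orbit lying in \<open>U\<close>, while \<open>V\<close> keeps \<open>y\<close>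
      away from that part.\<close>
    define A where "A = {g \<in> carrier G. b g y0 \<in> U}"
    have "x \<in> Y closure_of ((\<lambda>g. b g y0) ` A)"
      unfolding in_closure_of
    proof (intro conjI allI impI)
      fix T assume T: "x \<in> T \<and> openin Y T"
      then have "openin Y (T \<inter> U)" "x \<in> T \<inter> U" using UV by auto
      moreover have "x \<in> Y closure_of ((\<lambda>g. b g y0) ` carrier G)"
        using minimal_orbit_dense[OF Y y0] xy(1) by simp
      ultimately obtain g where "g \<in> carrier G" "b g y0 \<in> T \<inter> U" unfolding in_closure_of by blast
      then show "\<exists>y. y \<in> (\<lambda>g. b g y0) ` A \<and> y \<in> T" by (auto simp: A_def)
    qed (rule xy(1))
    then have "A \<in> j x" by (auto simp: j_def A_def)
    with xy(3) have "y \<in> Y closure_of ((\<lambda>g. b g y0) ` A)" by (auto simp: j_def)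
    with UV(2,4) obtain g where "g \<in> A" "b g y0 \<in> V" unfolding in_closure_of by blast
    with UV(5) show False by (auto simp: A_def disjnt_def)
  qed
  moreover have "j ` topspace Y \<subseteq> Pow (Pow (carrier G))" by (auto simp: j_def)
  ultimately show thesis by (rule that)
qed

text \<open>Universality is defined through flows on the type \<open>'g set set\<close>. An
  arbitrary minimal flow is transported there along the injection of
  \<open>minimal_gflow_embeds\<close>, and the factor map is carried back.\<close>

lemma universal_factor:
  fixes G :: "('g, 'm) monoid_scheme" and Y :: "'y topology"
  assumes X: "universal_minimal_flow G X a" and Y: "minimal_gflow G Y b"
  obtains f where "flow_hom G X a Y b f"
proof -
  have flow: "gflow G Y b" using Y by (simp add: minimal_gflow_def)
  let ?S = "topspace Y"
  obtain j :: "'y \<Rightarrow> 'g set set" where j: "inj_on j ?S" by (rule minimal_gflow_embeds[OF Y])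
  define i where "i = inv_into ?S j"
  have ij: "i (j y) = y" if "y \<in> ?S" for y using j that by (simp add: i_def)
  \<comment> \<open>Pulling the topology back along \<open>i\<close>, the inverse of
    \<open>j\<close>, makes \<open>j\<close> a homeomorphism onto the copy.\<close>
  define Y' where "Y' = pullback_topology (j ` ?S) i Y"
  define b' where "b' g z = j (b g (i z))" for g z
  have top: "topspace Y' = j ` ?S" using ij by (auto simp: Y'_def topspace_pullback_topology)
  have ci: "continuous_map Y' Y i"
    using continuous_map_pullback[OF continuous_map_id, of "j ` ?S" i Y] by (simp add: Y'_def)
  have "continuous_map Y Y (i \<circ> j)"
    by (rule continuous_map_eq[OF continuous_map_id]) (simp add: ij)
  then have cj: "continuous_map Y Y' j"
    unfolding Y'_def by (rule continuous_map_pullback') auto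
  have hom: "homeomorphic_maps Y Y' j i"
    unfolding homeomorphic_maps_def using ci cj ij top by auto
  then have hs: "Y homeomorphic_space Y'" by (auto simp: homeomorphic_space_def)
  have bY: "b g y \<in> ?S" if "g \<in> carrier G" "y \<in> ?S" for g y using gflow_closed[OF flow that] .
  have "gflow G Y' b'"
    unfolding gflow_def
  proof (intro conjI ballI)
    show "group G" "topspace Y' \<noteq> {}" using flow top by (auto simp: gflow_def)
    show "compact_space Y'" "Hausdorff_space Y'"
      using flow homeomorphic_compact_space[OF hs] homeomorphic_Hausdorff_space[OF hs] by (auto simp: gflow_def)
    show "continuous_map Y' Y' (b' g)" if "g \<in> carrier G" for g
    proof -
      have "continuous_map Y Y (b g)" using flow that by (simp add: gflow_def)
      then have "continuous_map Y' Y' (j \<circ> (b g \<circ> i))"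
        by (intro continuous_map_compose[OF _ cj] continuous_map_compose[OF ci])
      then show ?thesis by (simp add: b'_def[abs_def] o_def)
    qed
    show "b' \<one>\<^bsub>G\<^esub> z = z" if "z \<in> topspace Y'" for z
    proof -
      from that obtain y where y: "y \<in> ?S" "z = j y" using top by auto
      then have "b \<one>\<^bsub>G\<^esub> y = y" using flow by (simp add: gflow_def)
      then show ?thesis using y by (simp add: b'_def ij)
    qed
    show "b' (g \<otimes>\<^bsub>G\<^esub> h) z = b' g (b' h z)" if "g \<in> carrier G" "h \<in> carrier G" "z \<in> topspace Y'" for g h z
    proof -
      from that(3) obtain y where y: "y \<in> ?S" "z = j y" using top by auto
      then have "b (g \<otimes>\<^bsub>G\<^esub> h) y = b g (b h y)" using flow that(1,2) by (simp add: gflow_def)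
      then show ?thesis using y bY[OF that(2) y(1)] by (simp add: b'_def ij)
    qed
  qed
  moreover have "S = topspace Y'" if S: "closedin Y' S" "S \<noteq> {}" "\<forall>g\<in>carrier G. b' g ` S \<subseteq> S" for S
  proof -
    have sub: "S \<subseteq> j ` ?S" using closedin_subset[OF S(1)] top by simp
    have "{y \<in> ?S. j y \<in> S} = ?S"
    proof (rule minimal_gflow_eqI[OF Y])
      show "closedin Y {y \<in> ?S. j y \<in> S}" by (rule closedin_continuous_map_preimage[OF cj S(1)])
      show "{y \<in> ?S. j y \<in> S} \<noteq> {}" using S(2) sub by blast
      fix g y assume "g \<in> carrier G" "y \<in> {y \<in> ?S. j y \<in> S}"
      moreover from this have "b' g (j y) \<in> S" using S(3) by blast
      ultimately show "b g y \<in> {y \<in> ?S. j y \<in> S}" using bY ij by (simp add: b'_def)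
    qed
    then have "j ` ?S \<subseteq> S" by auto
    then show ?thesis using sub top by (simp add: subset_antisym)
  qed
  ultimately have "minimal_gflow G Y' b'" by (simp add: minimal_gflow_def)
  then obtain f where f: "gflow_factor_map G X a Y' b' f"
    using X by (auto simp: universal_minimal_flow_def)
  have i: "flow_hom G Y' b' Y b i"
    using ci bY ij by (auto simp: flow_hom_def top b'_def)
  have "flow_hom G X a Y' b' f" using f by (simp add: gflow_factor_map_def flow_hom_def)
  from flow_hom_compose[OF this i] show thesis by (rule that)
qed

section \<open>Coalescence of the universal minimal flow\<close>

text \<open>The space of self-maps of \<open>X\<close> under pointwise convergence, in which the
  enveloping semigroup is formed. Its points are extensional, hence the restricted composition
  \<open>compose\<close>.\<close>

definition pointwise_top :: "'x topology \<Rightarrow> ('x \<Rightarrow> 'x) topology" where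
  "pointwise_top X = product_topology (\<lambda>_. X) (topspace X)"

definition pointwise_act :: "'x topology \<Rightarrow> ('g \<Rightarrow> 'x \<Rightarrow> 'x) \<Rightarrow> 'g \<Rightarrow> ('x \<Rightarrow> 'x) \<Rightarrow> 'x \<Rightarrow> 'x" where
  "pointwise_act X a g p = compose (topspace X) (a g) p"

lemma topspace_pointwise: "topspace (pointwise_top X) = topspace X \<rightarrow>\<^sub>E topspace X"
  by (simp add: pointwise_top_def)

lemma continuous_map_pointwise:
  "continuous_map Y (pointwise_top X) f \<longleftrightarrow>
    f ` topspace Y \<subseteq> extensional (topspace X) \<and> (\<forall>x\<in>topspace X. continuous_map Y X (\<lambda>y. f y x))"
  unfolding pointwise_top_def by (simp add: continuous_map_componentwise image_subset_iff_funcset)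

lemma continuous_map_eval:
  "x \<in> topspace X \<Longrightarrow> continuous_map (pointwise_top X) X (\<lambda>p. p x)"
  unfolding pointwise_top_def by (rule continuous_map_product_projection)

text \<open>Evaluating the composite at \<open>x\<close> means evaluating \<open>p\<close> at
  \<open>q x\<close>, so continuity in the left factor holds even for discontinuous
  \<open>q\<close>. Later closure arguments therefore vary the left factor.\<close>

lemma continuous_map_right_compose:
  assumes "q \<in> topspace (pointwise_top X)"
  shows "continuous_map (pointwise_top X) (pointwise_top X) (\<lambda>p. compose (topspace X) p q)"
  unfolding continuous_map_pointwise
proof (intro conjI ballI)
  show "(\<lambda>p. compose (topspace X) p q) ` topspace (pointwise_top X) \<subseteq> extensional (topspace X)"
    by (auto simp: compose_extensional)
  fix x assume x: "x \<in> topspace X"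
  then have "q x \<in> topspace X" using assms by (auto simp: topspace_pointwise)
  then show "continuous_map (pointwise_top X) X (\<lambda>p. compose (topspace X) p q x)"
    using x continuous_map_eval by (simp add: compose_def)
qed

lemma gflow_pointwise:
  assumes "gflow G X a"
  shows "gflow G (pointwise_top X) (pointwise_act X a)"
proof -
  let ?S = "topspace X" and ?T = "pointwise_top X"
  have G: "group G" using assms by (simp add: gflow_def)
  have "(\<lambda>x\<in>?S. x) \<in> topspace ?T" by (simp add: topspace_pointwise)
  then have "topspace ?T \<noteq> {}" by blast
  moreover have "compact_space ?T" "Hausdorff_space ?T"
    using assms by (auto simp: pointwise_top_def gflow_def compact_space_product_topology Hausdorff_space_product_topology)
  moreover have "continuous_map ?T ?T (pointwise_act X a g)" if "g \<in> carrier G" for g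
    unfolding continuous_map_pointwise
  proof (intro conjI ballI)
    show "pointwise_act X a g ` topspace ?T \<subseteq> extensional ?S"
      by (auto simp: pointwise_act_def compose_extensional)
    fix x assume x: "x \<in> ?S"
    have "continuous_map X X (a g)" using assms that by (simp add: gflow_def)
    from continuous_map_compose[OF continuous_map_eval[OF x] this]
    show "continuous_map ?T X (\<lambda>p. pointwise_act X a g p x)"
      using x by (simp add: pointwise_act_def compose_def o_def)
  qed
  moreover have "pointwise_act X a \<one>\<^bsub>G\<^esub> p = p" if "p \<in> topspace ?T" for p
  proof (rule extensionalityI[of _ ?S])
    show "pointwise_act X a \<one>\<^bsub>G\<^esub> p \<in> extensional ?S" by (simp add: pointwise_act_def compose_extensional)
    show "p \<in> extensional ?S" using that by (auto simp: topspace_pointwise PiE_def)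
    fix x assume x: "x \<in> ?S"
    then have "p x \<in> ?S" using that by (auto simp: topspace_pointwise)
    then have "a \<one>\<^bsub>G\<^esub> (p x) = p x" using assms by (simp add: gflow_def)
    then show "pointwise_act X a \<one>\<^bsub>G\<^esub> p x = p x" using x by (simp add: pointwise_act_def compose_def)
  qed
  moreover have "pointwise_act X a (g \<otimes>\<^bsub>G\<^esub> h) p = pointwise_act X a g (pointwise_act X a h p)"
    if "g \<in> carrier G" "h \<in> carrier G" "p \<in> topspace ?T" for g h p
  proof (rule extensionalityI[of _ ?S])
    fix x assume x: "x \<in> ?S"
    then have "p x \<in> ?S" using that by (auto simp: topspace_pointwise)
    then have "a (g \<otimes>\<^bsub>G\<^esub> h) (p x) = a g (a h (p x))" using assms that by (simp add: gflow_def)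
    then show "pointwise_act X a (g \<otimes>\<^bsub>G\<^esub> h) p x = pointwise_act X a g (pointwise_act X a h p) x"
      using x by (simp add: pointwise_act_def compose_def)
  qed (simp_all add: pointwise_act_def compose_extensional)
  ultimately show ?thesis using G unfolding gflow_def by blast
qed

text \<open>The Ellis-Numakura argument. In a minimal closed subsemigroup \<open>N\<close>
  containing \<open>u\<close>, the set \<open>N u\<close> is again a closed subsemigroup, so it is
  \<open>N\<close> and contains \<open>u\<close>. Then the \<open>p\<close> with
  \<open>p u = u\<close> form a nonempty closed subsemigroup, so \<open>u\<close> is one of
  them.\<close>

lemma ellis_idempotent:
  assumes T: "compact_space (pointwise_top X)" "Hausdorff_space (pointwise_top X)"
    and L: "closedin (pointwise_top X) L" "L \<noteq> {}"
      "\<And>p q. p \<in> L \<Longrightarrow> q \<in> L \<Longrightarrow> compose (topspace X) p q \<in> L"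
  obtains u where "u \<in> L" "compose (topspace X) u u = u"
proof -
  let ?T = "pointwise_top X" and ?c = "compose (topspace X)"
  have LT: "L \<subseteq> topspace ?T" using L(1) closedin_subset by blast
  have assoc: "?c p (?c q r) = ?c (?c p q) r" if "r \<in> topspace ?T" for p q r
    using that compose_assoc[of r "topspace X" "topspace X" p q] by (auto simp: topspace_pointwise)
  obtain N where N: "N \<subseteq> L" "closedin ?T N" "N \<noteq> {}" "\<forall>p\<in>N. \<forall>q\<in>N. ?c p q \<in> N"
    and min: "\<And>N'. N' \<subseteq> N \<Longrightarrow> closedin ?T N' \<Longrightarrow> N' \<noteq> {} \<Longrightarrow> \<forall>p\<in>N'. \<forall>q\<in>N'. ?c p q \<in> N' \<Longrightarrow> N' = N"
  proof (rule compact_minimal_closed_set[OF T(1) L(1,2), of "\<lambda>N. \<forall>p\<in>N. \<forall>q\<in>N. ?c p q \<in> N"])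
    show "\<forall>p\<in>L. \<forall>q\<in>L. ?c p q \<in> L" using L(3) by blast
    show "\<forall>p\<in>\<Inter>\<C>. \<forall>q\<in>\<Inter>\<C>. ?c p q \<in> \<Inter>\<C>"
      if "\<And>S. S \<in> \<C> \<Longrightarrow> closedin ?T S \<and> (\<forall>p\<in>S. \<forall>q\<in>S. ?c p q \<in> S)" for \<C>
      using that by blast
  qed auto
  obtain u where u: "u \<in> N" using N(3) by blast
  have NT: "p \<in> topspace ?T" if "p \<in> N" for p using that N(1) LT by blast
  note cont = continuous_map_right_compose[OF NT[OF u]]
  have "(\<lambda>p. ?c p u) ` N = N"
  proof (rule min)
    show "(\<lambda>p. ?c p u) ` N \<subseteq> N" using N(4) u by blast
    show "closedin ?T ((\<lambda>p. ?c p u) ` N)"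
      using continuous_imp_closed_map[OF cont T] N(2) by (simp add: closed_map_def)
    show "(\<lambda>p. ?c p u) ` N \<noteq> {}" using u by blast
    show "\<forall>p\<in>(\<lambda>p. ?c p u) ` N. \<forall>q\<in>(\<lambda>p. ?c p u) ` N. ?c p q \<in> (\<lambda>p. ?c p u) ` N"
    proof clarify
      fix p q assume pq: "p \<in> N" "q \<in> N"
      have "?c (?c p u) (?c q u) = ?c (?c (?c p u) q) u" using assoc NT[OF u] by blast
      moreover have "?c (?c p u) q \<in> N" using N(4) pq u by blast
      ultimately show "?c (?c p u) (?c q u) \<in> (\<lambda>p. ?c p u) ` N" by blast
    qed
  qed
  then obtain w where w: "w \<in> N" "?c w u = u" using u by (metis imageE)
  have "{p \<in> N. ?c p u = u} = N"
  proof (rule min)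
    have "closedin ?T {p \<in> topspace ?T. ?c p u \<in> {u}}"
      using T(2) NT[OF u] by (intro closedin_continuous_map_preimage[OF cont]) (simp add: closedin_Hausdorff_singleton)
    moreover have "{p \<in> N. ?c p u = u} = N \<inter> {p \<in> topspace ?T. ?c p u \<in> {u}}" using NT by auto
    ultimately show "closedin ?T {p \<in> N. ?c p u = u}" using N(2) by (simp add: closedin_Int)
    show "{p \<in> N. ?c p u = u} \<noteq> {}" using w by blast
    show "\<forall>p\<in>{p \<in> N. ?c p u = u}. \<forall>q\<in>{p \<in> N. ?c p u = u}. ?c p q \<in> {p \<in> N. ?c p u = u}"
      using N(4) by (simp add: assoc[OF NT[OF u], symmetric])
  qed auto
  then have "?c u u = u" using u by blast
  then show thesis using that u N(1) by blast
qed

text \<open>The flow in question is a minimal left ideal of the enveloping semigroup. With an idempotent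
  \<open>u\<close> in it, every endomorphism is right multiplication by some \<open>v\<close> with \<open>u v = v\<close>, and such a
  \<open>v\<close> has a right inverse with respect to \<open>u\<close>.\<close>
lemma coalescent_flow_exists:
  assumes flow: "gflow G X a"
  obtains L where "L \<subseteq> topspace (pointwise_top X)"
    "minimal_gflow G (subtopology (pointwise_top X) L) (pointwise_act X a)"
    "\<forall>f. flow_hom G (subtopology (pointwise_top X) L) (pointwise_act X a)
       (subtopology (pointwise_top X) L) (pointwise_act X a) f \<longrightarrow> inj_on f L"
proof -
  let ?S = "topspace X" and ?T = "pointwise_top X" and ?c = "compose (topspace X)" and ?b = "pointwise_act X a"
  have G: "group G" using flow by (simp add: gflow_def)
  have Tflow: "gflow G ?T ?b" by (rule gflow_pointwise[OF flow])
  then have T: "compact_space ?T" "Hausdorff_space ?T" by (auto simp: gflow_def)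
  have aS: "a g x \<in> ?S" if "g \<in> carrier G" "x \<in> ?S" for g x using gflow_closed[OF flow that] .
  define \<Gamma> where "\<Gamma> = (\<lambda>g. restrict (a g) ?S) ` carrier G"
  \<comment> \<open>\<open>E\<close> is the enveloping semigroup of the flow.\<close>
  define E where "E = ?T closure_of \<Gamma>"
  have \<Gamma>T: "\<Gamma> \<subseteq> topspace ?T" using aS by (auto simp: \<Gamma>_def topspace_pointwise)
  then have \<Gamma>E: "\<Gamma> \<subseteq> E" by (simp add: E_def closure_of_subset)
  have ET: "E \<subseteq> topspace ?T" by (simp add: E_def closure_of_subset_topspace)
  have assoc: "?c p (?c q r) = ?c (?c p q) r" if "r \<in> topspace ?T" for p q r
    using that compose_assoc[of r "topspace X" "topspace X" p q] by (auto simp: topspace_pointwise)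
  have act: "?c (restrict (a g) ?S) p = ?b g p" if "p \<in> topspace ?T" for g p
    using that by (auto simp: pointwise_act_def compose_def topspace_pointwise fun_eq_iff restrict_def PiE_iff)
  have act_assoc: "?b g (?c p q) = ?c (?b g p) q" if "q \<in> topspace ?T" for g p q
    using assoc[OF that] by (simp add: pointwise_act_def)
  have "?b g ` \<Gamma> \<subseteq> \<Gamma>" if g: "g \<in> carrier G" for g
  proof clarify
    fix p assume "p \<in> \<Gamma>"
    then obtain h where h: "h \<in> carrier G" "p = restrict (a h) ?S" by (auto simp: \<Gamma>_def)
    have "g \<otimes>\<^bsub>G\<^esub> h \<in> carrier G" using G g h by (simp add: group.is_monoid monoid.m_closed)
    moreover have "?b g p = restrict (a (g \<otimes>\<^bsub>G\<^esub> h)) ?S"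
      using flow g h by (auto simp: gflow_def pointwise_act_def compose_def fun_eq_iff restrict_def)
    ultimately show "?b g p \<in> \<Gamma>" by (auto simp: \<Gamma>_def)
  qed
  then have Einv: "\<forall>g\<in>carrier G. ?b g ` E \<subseteq> E"
    using continuous_map_image_closure_subset[of ?T ?T _ \<Gamma>] closure_of_mono[of _ \<Gamma> ?T] Tflow
    unfolding E_def gflow_def by (meson order_trans)
  have "carrier G \<noteq> {}" using G by (simp add: group.is_monoid monoid.carrier_not_empty)
  then have "E \<noteq> {}" using \<Gamma>E by (auto simp: \<Gamma>_def)
  moreover have "closedin ?T E" by (simp add: E_def)
  ultimately obtain L where L: "L \<subseteq> E" "closedin ?T L" "minimal_gflow G (subtopology ?T L) ?b"
    using minimal_subflow_exists[OF Tflow _ _ Einv] by blast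
  let ?L = "subtopology ?T L"
  have LT: "L \<subseteq> topspace ?T" using L(1) ET by blast
  then have topL: "topspace ?L = L" by (simp add: Int_absorb1)
  have Lflow: "gflow G ?L ?b" using L(3) by (simp add: minimal_gflow_def)
  have Lact: "?b g p \<in> L" if "g \<in> carrier G" "p \<in> L" for g p
    using gflow_closed[OF Lflow that(1), unfolded topL, OF that(2)] .
  have Lne: "L \<noteq> {}" using Lflow topL unfolding gflow_def by simp
  \<comment> \<open>For fixed \<open>q\<close> the condition on \<open>p\<close> is closed and holds
    on \<open>\<Gamma>\<close> by invariance of \<open>L\<close>, so it passes to the closure
    \<open>E\<close>.\<close>
  have ideal: "?c p q \<in> L" if p: "p \<in> E" and q: "q \<in> L" for p q
  proof -
    have qT: "q \<in> topspace ?T" using q LT by blast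
    have "\<Gamma> \<subseteq> {p \<in> topspace ?T. ?c p q \<in> L}"
      using \<Gamma>T Lact q act[OF qT] by (auto simp: \<Gamma>_def)
    moreover have "closedin ?T {p \<in> topspace ?T. ?c p q \<in> L}"
      by (rule closedin_continuous_map_preimage[OF continuous_map_right_compose[OF qT] L(2)])
    ultimately have "E \<subseteq> {p \<in> topspace ?T. ?c p q \<in> L}" unfolding E_def by (rule closure_of_minimal)
    then show ?thesis using p by blast
  qed
  have idealL: "?c p q \<in> L" if "p \<in> L" "q \<in> L" for p q using ideal that L(1) by blast
  obtain u where u: "u \<in> L" "?c u u = u"
    using ellis_idempotent[OF T L(2) Lne idealL] by blast
  \<comment> \<open>The translate \<open>L q\<close> is a closed subflow of \<open>L\<close>, hence
    all of \<open>L\<close>.\<close>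
  have surj: "\<exists>p\<in>L. ?c p q = r" if q: "q \<in> L" and r: "r \<in> L" for q r
  proof -
    have qT: "q \<in> topspace ?T" using q LT by blast
    have "(\<lambda>p. ?c p q) ` L = topspace ?L"
    proof (rule minimal_gflow_eqI[OF L(3)])
      have "closedin ?T ((\<lambda>p. ?c p q) ` L)"
        using continuous_imp_closed_map[OF continuous_map_right_compose[OF qT] T] L(2) by (simp add: closed_map_def)
      then show "closedin ?L ((\<lambda>p. ?c p q) ` L)"
        using idealL[OF _ q] by (intro closedin_subset_topspace) auto
      show "(\<lambda>p. ?c p q) ` L \<noteq> {}" using Lne by blast
      fix g p assume "g \<in> carrier G" "p \<in> (\<lambda>p. ?c p q) ` L"
      then show "?b g p \<in> (\<lambda>p. ?c p q) ` L" using Lact act_assoc[OF qT] by auto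
    qed
    then show ?thesis using r topL by (metis (no_types, lifting) imageE)
  qed
  have right_id: "?c p u = p" if p: "p \<in> L" for p
  proof -
    obtain p' where p': "p' \<in> L" "?c p' u = p" using surj u(1) p by blast
    have "?c p u = ?c p' (?c u u)" using assoc[of u p' u] p'(2) u(1) LT by auto
    then show ?thesis using u(2) p'(2) by simp
  qed
  have "inj_on f L" if f: "flow_hom G ?L ?b ?L ?b f" for f
  proof -
    have fc: "continuous_map ?L ?L f" using f by (simp add: flow_hom_def)
    then have fL: "f p \<in> L" if "p \<in> L" for p
      using continuous_map_funspace[OF fc] that topL by auto
    have fact: "f (?b g p) = ?b g (f p)" if "g \<in> carrier G" "p \<in> L" for g p
      using f that topL by (simp add: flow_hom_def)
    \<comment> \<open>Equivariance is the case \<open>p \<in> \<Gamma>\<close>; both sides are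
      continuous in \<open>p\<close>, which extends it to \<open>E\<close>.\<close>
    have fmul: "f (?c p q) = ?c p (f q)" if p: "p \<in> E" and q: "q \<in> L" for p q
    proof -
      have qT: "q \<in> topspace ?T" "f q \<in> topspace ?T" using q LT fL by blast+
      let ?E = "subtopology ?T E"
      have topE: "topspace ?E = E" using ET by (simp add: Int_absorb1)
      have cE: "continuous_map ?E ?L (\<lambda>p. ?c p r)" if "r \<in> L" for r
        using continuous_map_right_compose[of r X] ideal that LT topE
        by (auto simp: continuous_map_in_subtopology continuous_map_from_subtopology)
      have "closedin ?E {p \<in> topspace ?E. (f \<circ> (\<lambda>p. ?c p q)) p = ?c p (f q)}"
        by (rule closedin_continuous_maps_eq[OF Hausdorff_space_subtopology[OF T(2)]
              continuous_map_compose[OF cE[OF q] fc] cE[OF fL[OF q]]])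
      then have "closedin ?T {p \<in> topspace ?E. (f \<circ> (\<lambda>p. ?c p q)) p = ?c p (f q)}"
        by (rule closedin_trans_full) (simp add: E_def)
      moreover have "\<Gamma> \<subseteq> {p \<in> topspace ?E. (f \<circ> (\<lambda>p. ?c p q)) p = ?c p (f q)}"
        using \<Gamma>E topE act qT fact q by (auto simp: \<Gamma>_def)
      ultimately have "E \<subseteq> {p \<in> topspace ?E. (f \<circ> (\<lambda>p. ?c p q)) p = ?c p (f q)}"
        unfolding E_def by (intro closure_of_minimal)
      then show ?thesis using p by auto
    qed
    define v where "v = f u"
    have vL: "v \<in> L" using fL u(1) by (simp add: v_def)
    have fv: "f p = ?c p v" if "p \<in> L" for p
      using fmul[of p u] right_id[OF that] that u(1) L(1) by (auto simp: v_def)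
    have uv: "?c u v = v" using fv[OF u(1)] by (simp add: v_def)
    obtain w where w: "w \<in> L" "?c w v = u" using surj vL u(1) by blast
    define w' where "w' = ?c u w"
    have w'L: "w' \<in> L" using idealL u(1) w(1) by (simp add: w'_def)
    have w'v: "?c w' v = u" using assoc[of v u w] vL LT w(2) u(2) by (auto simp: w'_def)
    \<comment> \<open>A left inverse \<open>t\<close> of the left inverse \<open>w'\<close> of
      \<open>v\<close> turns out to be \<open>v\<close> itself, so \<open>w'\<close> is also a right
      inverse and undoes right multiplication by \<open>v\<close>.\<close>
    obtain t where t: "t \<in> L" "?c t w' = u" using surj w'L u(1) by blast
    have "v = ?c (?c t w') v" using uv t(2) by simp
    also have "\<dots> = ?c t (?c w' v)" using assoc[of v t w'] vL LT by auto
    also have "\<dots> = t" using w'v right_id[OF t(1)] by simp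
    finally have vw': "?c v w' = u" using t(2) by simp
    have "?c (f p) w' = p" if "p \<in> L" for p
      using fv[OF that] assoc[of w' p v] vw' right_id[OF that] w'L LT by auto
    then show ?thesis by (rule inj_on_inverseI[where g = "\<lambda>q. ?c q w'"])
  qed
  then show thesis using that LT L(3) by blast
qed

text \<open>With a homomorphism \<open>p\<close> from \<open>X\<close> to the coalescent flow on
  \<open>L\<close> and an evaluation \<open>q\<close> back, \<open>p \<circ> (f \<circ> q)\<close>
  is an endomorphism on \<open>L\<close>, hence injective. As \<open>q\<close> is onto,
  \<open>f\<close> is injective; it is onto by minimality, and a homeomorphism by
  compactness.\<close>

lemma universal_endomorphism_homeomorphic:
  fixes X :: "'x topology"
  assumes X: "universal_minimal_flow G X a" and f: "flow_hom G X a X a f"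
  shows "homeomorphic_map X X f"
proof -
  have min: "minimal_gflow G X a" using X by (simp add: universal_minimal_flow_def)
  then have flow: "gflow G X a" by (simp add: minimal_gflow_def)
  obtain L where L: "L \<subseteq> topspace (pointwise_top X)"
    "minimal_gflow G (subtopology (pointwise_top X) L) (pointwise_act X a)"
    and inj: "\<forall>f. flow_hom G (subtopology (pointwise_top X) L) (pointwise_act X a)
       (subtopology (pointwise_top X) L) (pointwise_act X a) f \<longrightarrow> inj_on f L"
    by (rule coalescent_flow_exists[OF flow])
  let ?L = "subtopology (pointwise_top X) L" and ?b = "pointwise_act X a"
  have topL: "topspace ?L = L" using L(1) by (simp add: Int_absorb1)
  obtain p where p: "flow_hom G X a ?L ?b p" by (rule universal_factor[OF X L(2)])
  obtain x0 where x0: "x0 \<in> topspace X" by (rule gflow_point[OF flow])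
  define q where "q l = l x0" for l :: "'x \<Rightarrow> 'x"
  have q: "flow_hom G ?L ?b X a q"
    unfolding flow_hom_def q_def
    using continuous_map_from_subtopology[OF continuous_map_eval[OF x0]] x0
    by (auto simp: pointwise_act_def compose_def)
  have "gflow G ?L ?b" using L(2) by (simp add: minimal_gflow_def)
  from flow_hom_image[OF q this min] have qL: "q ` L = topspace X" by (simp only: topL)
  have "inj_on (p \<circ> (f \<circ> q)) L"
    by (rule inj[rule_format, OF flow_hom_compose[OF flow_hom_compose[OF q f] p]])
  then have "inj_on f (q ` L)" by (auto simp: inj_on_def)
  then have "inj_on f (topspace X)" by (simp add: qL)
  then show ?thesis
    using flow f flow_hom_image[OF f flow min]
    by (intro continuous_imp_homeomorphic_map) (auto simp: gflow_def flow_hom_def)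
qed

lemma universal_lift_automorphism:
  assumes X: "universal_minimal_flow G X a" and Y: "minimal_gflow G Y b"
    and f: "flow_hom G X a Y b f" and k: "flow_hom G Y b Y b k"
  obtains \<phi> where "\<phi> \<in> flow_aut G X a" "\<And>x. x \<in> topspace X \<Longrightarrow> f (\<phi> x) = k (f x)"
proof -
  have min: "minimal_gflow G X a" using X by (simp add: universal_minimal_flow_def)
  then have flow: "gflow G X a" by (simp add: minimal_gflow_def)
  have aX: "a g x \<in> topspace X" if "g \<in> carrier G" "x \<in> topspace X" for g x
    using gflow_closed[OF flow that] .
  let ?XX = "prod_topology X X"
  define c where "c g z = (a g (fst z), a g (snd z))" for g z
  have XX: "gflow G ?XX c"
    unfolding gflow_def
  proof (intro conjI ballI)
    show "group G" "topspace ?XX \<noteq> {}" using flow unfolding gflow_def by auto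
    show "compact_space ?XX" "Hausdorff_space ?XX"
      using flow by (auto simp: gflow_def compact_space_prod_topology Hausdorff_space_prod_topology)
    show "continuous_map ?XX ?XX (c g)" if "g \<in> carrier G" for g
    proof -
      have "continuous_map X X (a g)" using flow that by (simp add: gflow_def)
      then have "continuous_map ?XX X (a g \<circ> fst)" "continuous_map ?XX X (a g \<circ> snd)"
        by (auto intro: continuous_map_compose continuous_map_fst continuous_map_snd)
      then show ?thesis by (simp add: c_def[abs_def] o_def continuous_map_pairedI)
    qed
    show "c \<one>\<^bsub>G\<^esub> z = z" if "z \<in> topspace ?XX" for z
      using that flow by (auto simp: c_def gflow_def)
    show "c (g \<otimes>\<^bsub>G\<^esub> h) z = c g (c h z)" if "g \<in> carrier G" "h \<in> carrier G" "z \<in> topspace ?XX" for g h z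
      using that flow by (auto simp: c_def gflow_def)
  qed
  define P where "P = {z \<in> topspace ?XX. (f \<circ> snd) z = (k \<circ> (f \<circ> fst)) z}"
  have fc: "continuous_map X Y f" and kc: "continuous_map Y Y k" using f k by (auto simp: flow_hom_def)
  have f_in: "f x \<in> topspace Y" if "x \<in> topspace X" for x using continuous_map_funspace[OF fc] that by blast
  have k_in: "k y \<in> topspace Y" if "y \<in> topspace Y" for y using continuous_map_funspace[OF kc] that by blast
  have "Hausdorff_space Y" using Y by (simp add: minimal_gflow_def gflow_def)
  then have "closedin ?XX P"
    unfolding P_def
    by (rule closedin_continuous_maps_eq)
      (intro continuous_map_compose[OF _ fc] continuous_map_compose[OF _ kc] continuous_map_fst continuous_map_snd)+
  moreover have "P \<noteq> {}"
  proof -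
    obtain x where x: "x \<in> topspace X" by (rule gflow_point[OF flow])
    have "k (f x) \<in> f ` topspace X" using flow_hom_image[OF f flow Y] k_in[OF f_in[OF x]] by simp
    then obtain y where "y \<in> topspace X" "f y = k (f x)" by force
    then have "(x, y) \<in> P" using x by (simp add: P_def)
    then show ?thesis by blast
  qed
  moreover have "\<forall>g\<in>carrier G. c g ` P \<subseteq> P"
  proof (intro ballI image_subsetI)
    fix g z assume g: "g \<in> carrier G" and "z \<in> P"
    then obtain x y where z: "z = (x, y)" and xy': "x \<in> topspace X" "y \<in> topspace X" "f y = k (f x)"
      by (auto simp: P_def)
    then have "f (a g y) = k (f (a g x))" using f k g f_in by (simp add: flow_hom_def)
    then show "c g z \<in> P" using xy' aX g by (simp add: z P_def c_def)
  qed
  ultimately obtain N where N: "N \<subseteq> P" "closedin ?XX N" "minimal_gflow G (subtopology ?XX N) c"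
    by (rule minimal_subflow_exists[OF XX])
  let ?N = "subtopology ?XX N"
  obtain h where h: "flow_hom G X a ?N c h" by (rule universal_factor[OF X N(3)])
  have hN: "h x \<in> P" if "x \<in> topspace X" for x
    using h that N(1) continuous_map_funspace[of X ?N h] by (auto simp: flow_hom_def)
  have proj: "flow_hom G ?N c X a fst" "flow_hom G ?N c X a snd"
    by (auto simp: flow_hom_def c_def continuous_map_from_subtopology continuous_map_fst continuous_map_snd)
  \<comment> \<open>Both coordinates of \<open>h\<close> are endomorphisms of \<open>X\<close>,
    hence homeomorphisms. The lift will be the second coordinate after the inverse \<open>i\<close>
    of the first.\<close>
  have h1: "flow_hom G X a X a (fst \<circ> h)" and h2: "flow_hom G X a X a (snd \<circ> h)"
    using flow_hom_compose[OF h] proj by blast+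
  have m1: "homeomorphic_map X X (fst \<circ> h)" by (rule universal_endomorphism_homeomorphic[OF X h1])
  then obtain i where i: "homeomorphic_maps X X (fst \<circ> h) i" unfolding homeomorphic_map_maps by blast
  then have ic: "continuous_map X X i" and i1: "\<And>x. x \<in> topspace X \<Longrightarrow> i (fst (h x)) = x"
    and i2: "\<And>x. x \<in> topspace X \<Longrightarrow> fst (h (i x)) = x"
    by (auto simp: homeomorphic_maps_def)
  have i_in: "i x \<in> topspace X" if "x \<in> topspace X" for x using continuous_map_funspace[OF ic] that by blast
  have ieq: "i (a g x) = a g (i x)" if g: "g \<in> carrier G" and x: "x \<in> topspace X" for g x
  proof -
    have "fst (h (a g (i x))) = a g (fst (h (i x)))" using h1 g i_in[OF x] by (simp add: flow_hom_def)
    then have "fst (h (a g (i x))) = a g x" using i2[OF x] by simp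
    then show ?thesis using i1[OF aX[OF g i_in[OF x]]] by simp
  qed
  have "flow_hom G X a X a i" using ic ieq by (simp add: flow_hom_def)
  from flow_hom_compose[OF this h2] have \<psi>: "flow_hom G X a X a ((snd \<circ> h) \<circ> i)" .
  \<comment> \<open>The value outside the space is the normalisation that \<open>flow_aut\<close>
    demands.\<close>
  define \<phi> where "\<phi> x = (if x \<in> topspace X then snd (h (i x)) else x)" for x
  have "homeomorphic_map X X \<phi>"
    using universal_endomorphism_homeomorphic[OF X \<psi>]
    by (rule homeomorphic_map_eq) (simp add: \<phi>_def)
  then have "\<phi> \<in> flow_aut G X a"
    using \<psi> aX by (auto simp: flow_aut_def flow_hom_def \<phi>_def)
  moreover have "f (\<phi> x) = k (f x)" if "x \<in> topspace X" for x
    using hN[OF i_in[OF that]] i2[OF that] that by (auto simp: \<phi>_def P_def)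
  ultimately show thesis by (rule that)
qed

section \<open>Automorphisms and proximality\<close>

lemma flow_aut_hom: "\<phi> \<in> flow_aut G X a \<Longrightarrow> flow_hom G X a X a \<phi>"
  by (auto simp: flow_aut_def flow_hom_def homeomorphic_imp_continuous_map)

lemma flow_aut_eqI:
  assumes X: "minimal_gflow G X a" and f: "f \<in> flow_aut G X a" and h: "h \<in> flow_aut G X a"
    and x0: "x0 \<in> topspace X" "f x0 = h x0"
  shows "f = h"
proof
  fix x
  have "Hausdorff_space X" using X by (simp add: minimal_gflow_def gflow_def)
  then show "f x = h x"
    using flow_hom_eqI[OF flow_aut_hom[OF f] flow_aut_hom[OF h] X _ x0] f h
    by (cases "x \<in> topspace X") (auto simp: flow_aut_def)
qed

lemma id_flow_aut: "(\<lambda>x. x) \<in> flow_aut G X a"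
  by (simp add: flow_aut_def homeomorphic_map_id[unfolded id_def])

text \<open>If \<open>x\<close> and \<open>f x\<close> are both driven to \<open>y\<close> along
  \<open>F\<close>, continuity of \<open>f\<close> gives \<open>f y = y\<close>; on a minimal flow
  an automorphism with a fixed point is the identity.\<close>

lemma not_proximal_if_automorphism:
  assumes X: "minimal_gflow G X a" and f: "f \<in> flow_aut G X a" "f \<noteq> (\<lambda>x. x)"
  shows "\<not> proximal_flow G X a"
proof
  assume prox: "proximal_flow G X a"
  have flow: "gflow G X a" using X by (simp add: minimal_gflow_def)
  then have Hd: "Hausdorff_space X" by (simp add: gflow_def)
  obtain x where x: "x \<in> topspace X" by (rule gflow_point[OF flow])
  have hom: "flow_hom G X a X a f" by (rule flow_aut_hom[OF f(1)])
  then have fc: "continuous_map X X f" by (simp add: flow_hom_def)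
  then have "f x \<in> topspace X" using x continuous_map_funspace by blast
  with prox x obtain y F where F: "F \<noteq> bot" "eventually (\<lambda>g. g \<in> carrier G) F"
    "limitin X (\<lambda>g. a g x) y F" "limitin X (\<lambda>g. a g (f x)) y F"
    unfolding proximal_flow_def by blast
  have "eventually (\<lambda>g. (f \<circ> (\<lambda>g. a g x)) g = a g (f x)) F"
    using F(2) by (rule eventually_mono) (use hom x in \<open>simp add: flow_hom_def\<close>)
  then have "limitin X (\<lambda>g. a g (f x)) (f y) F"
    by (rule limitin_transform_eventually[OF _ continuous_map_limit[OF fc F(3)]])
  then have fy: "f y = y" by (rule limitin_Hausdorff_unique[OF _ F(4) F(1) Hd])
  have "y \<in> topspace X" using F(3) by (rule limitin_topspace)
  from flow_aut_eqI[OF X f(1) id_flow_aut this fy] have "f = (\<lambda>x. x)" .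
  with f(2) show False by simp
qed

section \<open>A minimal subshift invariant under flips\<close>

text \<open>Distances are invariant under right multiplication because \<open>shift\<close> and the
  placing of patterns multiply on the right. Finite balls make patterns of bounded radius finite
  objects.\<close>

locale proper_metric_group =
  fixes mul :: "'a \<Rightarrow> 'a \<Rightarrow> 'a" (infixl "\<cdot>" 70)
    and e :: 'a and iv :: "'a \<Rightarrow> 'a" and dst :: "'a \<Rightarrow> 'a \<Rightarrow> nat"
  assumes assoc: "(g \<cdot> h) \<cdot> k = g \<cdot> (h \<cdot> k)"
    and unit_l [simp]: "e \<cdot> g = g" and unit_r [simp]: "g \<cdot> e = g"
    and inv_l [simp]: "iv g \<cdot> g = e" and inv_r [simp]: "g \<cdot> iv g = e"
    and dst_refl [simp]: "dst g g = 0"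
    and dst_sym: "dst g h = dst h g"
    and dst_tri: "dst g k \<le> dst g h + dst h k"
    and dst_mul [simp]: "dst (g \<cdot> k) (h \<cdot> k) = dst g h"
    and finite_ball: "finite {h. dst g h \<le> n}"
    and infinite_group: "infinite (UNIV :: 'a set)"
begin

section \<open>Separated sets and nets\<close>

definition separated :: "nat \<Rightarrow> 'a set \<Rightarrow> bool" where
  "separated q D \<longleftrightarrow> (\<forall>g\<in>D. \<forall>h\<in>D. dst g h \<le> q \<longrightarrow> g = h)"

definition net :: "nat \<Rightarrow> 'a set \<Rightarrow> bool" where
  "net q D \<longleftrightarrow> separated q D \<and> (\<forall>g. \<exists>h\<in>D. dst g h \<le> q)"

lemma mul_inv_cancel [simp]: "(g \<cdot> h) \<cdot> iv h = g" "(g \<cdot> iv h) \<cdot> h = g"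
  by (simp_all add: assoc)

lemma dst_mul_left: "dst (g \<cdot> h) h = dst g e"
  using dst_mul[of g h e] by simp

text \<open>A maximal separated set is a net, since a point farther than \<open>q\<close> from it
  could be added. Starting from a given \<open>D\<close> matters in the gluing argument, where net
  points already placed must survive.\<close>

lemma separated_extends_to_net:
  assumes "separated q D"
  obtains D' where "D \<subseteq> D'" "net q D'"
proof -
  define A where "A = {D'. D \<subseteq> D' \<and> separated q D'}"
  have "\<exists>M\<in>A. \<forall>X\<in>A. M \<subseteq> X \<longrightarrow> X = M"
  proof (rule subset_Zorn_nonempty)
    show "A \<noteq> {}" using assms by (auto simp: A_def)
    fix C assume C: "C \<noteq> {}" "subset.chain A C"
    have "separated q (\<Union>C)"
      unfolding separated_def
    proof (intro ballI impI)
      fix g h assume gh: "g \<in> \<Union>C" "h \<in> \<Union>C" "dst g h \<le> q"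
      then obtain X Y where XY: "X \<in> C" "Y \<in> C" "g \<in> X" "h \<in> Y" by blast
      with C have "X \<subseteq> Y \<or> Y \<subseteq> X" by (auto simp: subset_chain_def)
      then obtain Z where "Z \<in> C" "g \<in> Z" "h \<in> Z" using XY by blast
      with C gh show "g = h" by (auto simp: subset_chain_def A_def separated_def)
    qed
    moreover have "D \<subseteq> \<Union>C" using C by (fastforce simp: A_def subset_chain_def)
    ultimately show "\<Union>C \<in> A" by (simp add: A_def)
  qed
  then obtain M where M: "M \<in> A" "\<And>X. X \<in> A \<Longrightarrow> M \<subseteq> X \<Longrightarrow> X = M" by blast
  have "\<exists>h\<in>M. dst g h \<le> q" for g
  proof (rule ccontr)
    assume no: "\<not> (\<exists>h\<in>M. dst g h \<le> q)"
    then have "insert g M \<in> A"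
      using M(1) by (auto simp: A_def separated_def dst_sym)
    from M(2)[OF this] have "g \<in> M" by blast
    with no show False using dst_refl[of g] by (metis le0)
  qed
  with M(1) show thesis by (intro that[of M]) (auto simp: A_def net_def)
qed

lemma net_infinite:
  assumes "net q D" shows "infinite D"
proof
  assume "finite D"
  then have "finite (\<Union>h\<in>D. {g. dst h g \<le> q})" using finite_ball by blast
  moreover have "(\<Union>h\<in>D. {g. dst h g \<le> q}) = UNIV"
    using assms by (auto simp: net_def dst_sym)
  ultimately show False using infinite_group by simp
qed

lemma net_translate:
  assumes "net q D" shows "net q {g. g \<cdot> h \<in> D}"
  unfolding net_def separated_def
proof (intro conjI ballI impI allI)
  fix g k assume "g \<in> {g. g \<cdot> h \<in> D}" "k \<in> {g. g \<cdot> h \<in> D}" "dst g k \<le> q"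
  then have "g \<cdot> h = k \<cdot> h" using assms by (auto simp: net_def separated_def)
  then show "g = k" by (metis mul_inv_cancel(1))
next
  fix g
  obtain k where "k \<in> D" "dst (g \<cdot> h) k \<le> q" using assms by (auto simp: net_def)
  then show "\<exists>k\<in>{g. g \<cdot> h \<in> D}. dst g k \<le> q"
    by (intro bexI[of _ "k \<cdot> iv h"]) (use dst_mul[of g h "k \<cdot> iv h"] in auto)
qed

end

section \<open>Truncation of indices\<close>

definition trunc :: "nat \<Rightarrow> nat set \<Rightarrow> nat set" where
  "trunc m i = i \<inter> {..<m}"

lemma trunc_trunc [simp]: "trunc m (trunc m i) = trunc m i"
  by (auto simp: trunc_def)

lemma trunc_Suc [simp]: "trunc m (trunc (Suc m) i) = trunc m i"
  by (auto simp: trunc_def)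

lemma finite_range_trunc: "finite (range (trunc m))"
  by (rule finite_subset[of _ "Pow {..<m}"]) (auto simp: trunc_def)

text \<open>The inverse of \<open>trunc m\<close> on \<open>J\<close> is extended to a
  truncation-preserving map of all indices. Such reindexings preserve sets admissible at stage
  \<open>m\<close>, so patterns on \<open>J\<close> can be moved to the standard window
  \<open>range (trunc m)\<close>.\<close>

lemma trunc_section:
  assumes "inj_on (trunc m) J"
  obtains t where "\<And>i. trunc m (t i) = trunc m i" "\<And>i. i \<in> J \<Longrightarrow> t (trunc m i) = i"
proof
  let ?P = "\<lambda>j i. i \<in> J \<and> trunc m i = trunc m j"
  let ?t = "\<lambda>j. if \<exists>i. ?P j i then SOME i. ?P j i else j"
  show "trunc m (?t j) = trunc m j" for j
    using someI_ex[of "?P j"] by auto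
  show "?t (trunc m i) = i" if "i \<in> J" for i
  proof -
    have ex: "\<exists>k. ?P (trunc m i) k" using that by auto
    from someI_ex[OF this] have "(SOME k. ?P (trunc m i) k) = i"
      using assms that by (auto simp: inj_on_def)
    with ex show ?thesis by simp
  qed
qed

text \<open>The index set \<open>nat set\<close> has the cardinality of the continuum, so the group of flips has cardinality
  \<open>2^c\<close>. Its truncations organise it as a tree: stage \<open>m\<close> of the construction only controls families
  of indices with distinct truncations to \<open>m\<close>, which are finite.\<close>
type_synonym 'a config = "'a \<Rightarrow> nat set \<Rightarrow> bool"

definition flip :: "(nat set \<Rightarrow> bool) \<Rightarrow> 'a config \<Rightarrow> 'a config" where
  "flip k x = (\<lambda>g i. x g i \<noteq> k i)"

context proper_metric_group
begin

section \<open>Admissible sets and their patterns\<close>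

definition shift :: "'a \<Rightarrow> 'a config \<Rightarrow> 'a config" where
  "shift h x = (\<lambda>g. x (g \<cdot> h))"

text \<open>Strong irreducibility. The relation \<open>R\<close> prescribes at each point \<open>b\<close> of its domain the value of a
  configuration \<open>y\<close> that does not change on \<open>d\<close>-clusters.\<close>
definition gluing :: "nat \<Rightarrow> 'a config set \<Rightarrow> bool" where
  "gluing d W \<longleftrightarrow> (\<forall>R. (\<forall>(b, y)\<in>R. y \<in> W) \<and>
       (\<forall>(b, y)\<in>R. \<forall>(b', y')\<in>R. dst b b' \<le> d \<longrightarrow> y = y') \<longrightarrow>
     (\<exists>z\<in>W. \<forall>(b, y)\<in>R. z b = y b))"

text \<open>The clause on \<open>t\<close> allows indices of equal truncation to be substituted for
  one another; it reduces all windows \<open>J\<close> to the one finite window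
  \<open>range (trunc m)\<close>. The gluing distance may vary with the stage.\<close>

definition admissible :: "nat \<Rightarrow> 'a config set \<Rightarrow> bool" where
  "admissible m W \<longleftrightarrow> (\<forall>x\<in>W. \<forall>h. shift h x \<in> W) \<and> (\<forall>x\<in>W. \<forall>k. flip k x \<in> W) \<and>
     (\<forall>x\<in>W. \<forall>t. (\<forall>i. trunc m (t i) = trunc m i) \<longrightarrow> (\<lambda>g i. x g (t i)) \<in> W) \<and>
     (\<exists>d. gluing d W)"

text \<open>\<open>H\<close> lists the places where a pattern may occur; a finite \<open>H\<close>
  together with shift invariance gives bounded gaps. Each \<open>J\<close> is finite, having at most
  one index for each truncation.\<close>

definition shows_patterns :: "nat \<Rightarrow> 'a config set \<Rightarrow> 'a set \<Rightarrow> 'a config \<Rightarrow> bool" where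
  "shows_patterns m W H x \<longleftrightarrow> (\<forall>y\<in>W. \<forall>J. inj_on (trunc m) J \<longrightarrow>
     (\<exists>h\<in>H. \<forall>g i. dst g e \<le> m \<longrightarrow> i \<in> J \<longrightarrow> x (g \<cdot> h) i = y g i))"

text \<open>\<open>flip k x\<close> shows \<open>y\<close> wherever \<open>x\<close> shows
  \<open>flip k y\<close>, and flip invariance makes the latter a member of
  \<open>W\<close>.\<close>

lemma shows_patterns_flip:
  assumes "shows_patterns m W H x" "admissible m W"
  shows "shows_patterns m W H (flip k x)"
  unfolding shows_patterns_def
proof (intro ballI allI impI)
  fix y J assume y: "y \<in> W" and J: "inj_on (trunc m) J"
  have "flip k y \<in> W" using assms(2) y by (simp add: admissible_def)
  from assms(1)[unfolded shows_patterns_def, rule_format, OF this J]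
  obtain h where "h \<in> H" "\<forall>g i. dst g e \<le> m \<longrightarrow> i \<in> J \<longrightarrow> x (g \<cdot> h) i = flip k y g i"
    by auto
  then show "\<exists>h\<in>H. \<forall>g i. dst g e \<le> m \<longrightarrow> i \<in> J \<longrightarrow> flip k x (g \<cdot> h) i = y g i"
    by (intro bexI[of _ h]) (auto simp: flip_def)
qed

lemma shows_patterns_reindex:
  assumes "shows_patterns m W H x" "admissible m W" and t: "\<And>i. trunc m (t i) = trunc m i"
  shows "shows_patterns m W H (\<lambda>g i. x g (t i))"
  unfolding shows_patterns_def
proof (intro ballI allI impI)
  fix y J assume y: "y \<in> W" and J: "inj_on (trunc m) J"
  from J obtain u where u: "\<And>i. trunc m (u i) = trunc m i" "\<And>i. i \<in> J \<Longrightarrow> u (trunc m i) = i"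
    using trunc_section by blast
  \<comment> \<open>\<open>?y\<close> reads an index only through its truncation, which
    \<open>t\<close> preserves, so for \<open>i \<in> J\<close> its value at \<open>t i\<close> is
    that of \<open>y\<close> at \<open>i\<close>.\<close>
  let ?y = "\<lambda>g i. y g (u (trunc m i))"
  have y': "?y \<in> W" using assms(2) y u unfolding admissible_def by auto
  have J': "inj_on (trunc m) (t ` J)" using J t by (auto simp: inj_on_def)
  from assms(1)[unfolded shows_patterns_def, rule_format, OF y' J']
  obtain h where "h \<in> H" "\<forall>g i. dst g e \<le> m \<longrightarrow> i \<in> t ` J \<longrightarrow> x (g \<cdot> h) i = ?y g i"
    by auto
  then show "\<exists>h\<in>H. \<forall>g i. dst g e \<le> m \<longrightarrow> i \<in> J \<longrightarrow> x (g \<cdot> h) (t i) = y g i"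
    by (intro bexI[of _ h]) (auto simp: t u(2))
qed

text \<open>Already at distance 0 the hypothesis on \<open>R\<close> gives one value per point, and
  among all configurations these can be prescribed independently.\<close>

lemma admissible_UNIV: "admissible 0 UNIV"
proof -
  have "gluing 0 (UNIV :: 'a config set)"
    unfolding gluing_def
  proof (intro allI impI)
    fix R :: "('a \<times> 'a config) set"
    assume R: "(\<forall>(b, y)\<in>R. y \<in> UNIV) \<and> (\<forall>(b, y)\<in>R. \<forall>(b', y')\<in>R. dst b b' \<le> 0 \<longrightarrow> y = y')"
    have "(SOME y. (b, y) \<in> R) = y" if "(b, y) \<in> R" for b y
      using someI[of "\<lambda>y. (b, y) \<in> R" y] R that by fastforce
    then show "\<exists>z\<in>UNIV. \<forall>(b, y)\<in>R. z b = y b"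
      by (intro bexI[of _ "\<lambda>b. (SOME y. (b, y) \<in> R) b"]) auto
  qed
  then show ?thesis by (auto simp: admissible_def)
qed

lemma shows_patterns_mono:
  "shows_patterns m W H x \<Longrightarrow> H \<subseteq> H' \<Longrightarrow> shows_patterns m W H' x"
  unfolding shows_patterns_def by (meson subsetD)

lemma shows_patterns_shift:
  assumes "shows_patterns m W ((\<lambda>g. g \<cdot> h) ` H) x"
  shows "shows_patterns m W H (shift h x)"
  unfolding shows_patterns_def
proof (intro ballI allI impI)
  fix y J assume "y \<in> W" "inj_on (trunc m) J"
  from assms[unfolded shows_patterns_def, rule_format, OF this]
  show "\<exists>h'\<in>H. \<forall>g i. dst g e \<le> m \<longrightarrow> i \<in> J \<longrightarrow> shift h x (g \<cdot> h') i = y g i"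
    by (auto simp: shift_def assoc)
qed

lemma shows_patterns_cong:
  assumes "shows_patterns m W H x" "\<And>g h. h \<in> H \<Longrightarrow> dst g e \<le> m \<Longrightarrow> z (g \<cdot> h) = x (g \<cdot> h)"
  shows "shows_patterns m W H z"
  unfolding shows_patterns_def
proof (intro ballI allI impI)
  fix y J assume "y \<in> W" "inj_on (trunc m) J"
  from assms(1)[unfolded shows_patterns_def, rule_format, OF this]
  show "\<exists>h\<in>H. \<forall>g i. dst g e \<le> m \<longrightarrow> i \<in> J \<longrightarrow> z (g \<cdot> h) i = y g i"
    using assms(2) by auto
qed

text \<open>The refined set asks for a net whose points each carry all patterns of \<open>W\<close> nearby. It can
  still be glued: keep the net points of the given configurations that are near the prescribed part, extend
  them to a net, and write a copy of every pattern around each new net point; maximality of the given nets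
  keeps new points away from the prescribed part.\<close>
lemma admissible_refine:
  assumes admissible: "admissible m W"
  obtains W' H where "admissible (Suc m) W'" "W' \<subseteq> W" "finite H"
    "\<And>x. x \<in> W' \<Longrightarrow> shows_patterns m W H x"
proof -
  obtain d where glue: "gluing d W" using admissible by (auto simp: admissible_def)
  \<comment> \<open>The pattern of \<open>y\<close> on the ball of radius \<open>m\<close> and the
    standard window, coded so that finitely many patterns arise.\<close>
  define P where "P = (\<lambda>y :: 'a config. {(g, i). dst g e \<le> m \<and> i \<in> range (trunc m) \<and> y g i})"
  have "P ` W \<subseteq> Pow ({g. dst e g \<le> m} \<times> range (trunc m))" by (auto simp: P_def dst_sym)
  then have finP: "finite (P ` W)"
    using finite_ball finite_range_trunc by (meson finite_Pow_iff finite_SigmaI finite_subset)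
  \<comment> \<open>Sites for the patterns: separation \<open>2 * m + d\<close> keeps the
    \<open>m\<close>-balls around distinct sites more than \<open>d\<close> apart, as gluing in
    \<open>W\<close> requires.\<close>
  obtain D0 where D0: "net (2 * m + d) D0"
    using separated_extends_to_net[of "2 * m + d" "{}"] by (auto simp: separated_def)
  have "P ` W \<lesssim> D0" using finP net_infinite[OF D0] by (simp add: finite_lepoll_infinite)
  then obtain f where f: "inj_on f (P ` W)" "f ` P ` W \<subseteq> D0" by (auto simp: lepoll_def)
  define S where "S = f ` P ` W"
  define Y where "Y = inv_into W P"
  have Y: "Y p \<in> W" "P (Y p) = p" if "p \<in> P ` W" for p
    using that by (auto simp: Y_def inv_into_into f_inv_into_f)
  obtain s0 where s0: "dst s e \<le> s0" if "s \<in> S" for s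
    using finP finite_nat_set_iff_bounded_le[of "(\<lambda>s. dst s e) ` S"] by (auto simp: S_def)
  \<comment> \<open>The \<open>v\<close>-ball around a net point contains every copy written around
    it, and \<open>q\<close>-separation puts the \<open>v\<close>-balls of distinct net points more
    than \<open>d\<close> apart.\<close>
  define v where "v = m + s0"
  define q where "q = 2 * v + d"
  define ok where "ok D x \<longleftrightarrow> net q D \<and> (\<forall>c\<in>D. shows_patterns m W ((\<lambda>s. s \<cdot> c) ` S) x)" for D x
  define W' where "W' = {x \<in> W. \<exists>D. ok D x}"
  \<comment> \<open>Some net point \<open>c\<close> is within \<open>q\<close> of the identity, and
    the sites \<open>s \<cdot> c\<close> are within \<open>s0\<close> of \<open>c\<close>.\<close>
  define H where "H = {h. dst e h \<le> q + s0}"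
  have pat: "shows_patterns m W H x" if "x \<in> W'" for x
  proof -
    from that obtain D where D: "ok D x" by (auto simp: W'_def)
    then obtain c where c: "c \<in> D" "dst e c \<le> q" by (auto simp: ok_def net_def)
    have "s \<cdot> c \<in> H" if "s \<in> S" for s
      using s0[OF that] c(2) dst_tri[of e "s \<cdot> c" c] dst_sym[of c "s \<cdot> c"]
      by (simp add: H_def dst_mul_left)
    then show ?thesis
      using D c(1) shows_patterns_mono[of m W "(\<lambda>s. s \<cdot> c) ` S" x H] by (auto simp: ok_def)
  qed
  have sh: "shift h x \<in> W'" if "x \<in> W'" for x h
  proof -
    from that obtain D where D: "ok D x" by (auto simp: W'_def)
    have "ok {g. g \<cdot> h \<in> D} (shift h x)"
      using D net_translate[of q D h]
      by (auto simp: ok_def image_image assoc intro!: shows_patterns_shift)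
    moreover have "shift h x \<in> W" using that admissible by (simp add: W'_def admissible_def)
    ultimately show ?thesis by (auto simp: W'_def)
  qed
  have fl: "flip k x \<in> W'" if "x \<in> W'" for x k
    using that admissible shows_patterns_flip[OF _ admissible] by (auto simp: W'_def ok_def admissible_def)
  have ri: "(\<lambda>g i. x g (t i)) \<in> W'" if "x \<in> W'" and t: "\<forall>i. trunc (Suc m) (t i) = trunc (Suc m) i" for x t
  proof -
    have t': "trunc m (t i) = trunc m i" for i using t by (metis trunc_Suc)
    then have "(\<lambda>g i. x g (t i)) \<in> W" using that(1) admissible by (simp add: W'_def admissible_def)
    then show ?thesis
      using that(1) shows_patterns_reindex[OF _ admissible, of _ _ t] t' by (auto simp: W'_def ok_def)
  qed
  \<comment> \<open>Here \<open>5 * q = 2 * (2 * q + v) + d\<close>, where \<open>2 * q + v\<close>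
    bounds how far the part kept of a given configuration reaches from where it was
    prescribed.\<close>
  have "gluing (5 * q) W'"
    unfolding gluing_def
  proof (intro allI impI, elim conjE)
    fix R assume RW: "\<forall>(b, y)\<in>R. y \<in> W'"
      and Rc: "\<forall>(b, y)\<in>R. \<forall>(b', y')\<in>R. dst b b' \<le> 5 * q \<longrightarrow> y = y'"
    have RcD: "y = y'" if "(b, y) \<in> R" "(b', y') \<in> R" "dst b b' \<le> 5 * q" for b y b' y'
      using bspec[OF Rc that(1)] that(2,3) by auto
    have RWD: "y \<in> W'" if "(b, y) \<in> R" for b y
      using bspec[OF RW that] by simp
    obtain N where N: "ok (N y) y" if "y \<in> W'" for y
      using bchoice[of W' "\<lambda>y D. ok D y"] by (auto simp: W'_def)
    define D1 where "D1 = {c. \<exists>b y. (b, y) \<in> R \<and> dst b c \<le> 2 * q \<and> c \<in> N y}"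
    have "separated q D1"
      unfolding separated_def
    proof (intro ballI impI)
      fix c c' assume "c \<in> D1" "c' \<in> D1" and cc: "dst c c' \<le> q"
      then obtain b y b' y' where b: "(b, y) \<in> R" "dst b c \<le> 2 * q" "c \<in> N y"
        and b': "(b', y') \<in> R" "dst b' c' \<le> 2 * q" "c' \<in> N y'" by (auto simp: D1_def)
      have "dst b b' \<le> 5 * q"
        using dst_tri[of b b' c] dst_tri[of c b' c'] b(2) b'(2) cc dst_sym[of c' b'] by linarith
      then have "y = y'" using RcD b(1) b'(1) by blast
      moreover have "ok (N y) y" by (rule N[OF RWD[OF b(1)]])
      ultimately show "c = c'" using b(3) b'(3) cc by (simp add: ok_def net_def separated_def)
    qed
    then obtain D where D: "D1 \<subseteq> D" "net q D" by (rule separated_extends_to_net)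
    have Dsep: "c = c'" if "c \<in> D" "c' \<in> D" "dst c c' \<le> q" for c c'
      using D(2) that by (simp add: net_def separated_def)
    \<comment> \<open>A new net point within \<open>q\<close> of \<open>b\<close> would, by density
      of \<open>N y\<close>, have a kept point within \<open>q\<close> of itself, against separation
      of \<open>D\<close>.\<close>
    have new: "q < dst b c" if "c \<in> D - D1" "(b, y) \<in> R" for b c y
    proof (rule ccontr)
      assume "\<not> q < dst b c"
      then have le: "dst b c \<le> q" by simp
      have "ok (N y) y" by (rule N[OF RWD[OF that(2)]])
      then obtain c' where c': "c' \<in> N y" "dst c c' \<le> q" by (auto simp: ok_def net_def)
      have "dst b c' \<le> 2 * q" using dst_tri[of b c' c] le c'(2) by linarith
      then have "c' \<in> D1" using that(2) c'(1) by (auto simp: D1_def)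
      with D(1) Dsep c'(2) that(1) show False by blast
    qed
    \<comment> \<open>The standard-window pattern \<open>Y p\<close>, centred at
      \<open>f p \<cdot> c\<close> and spread to all indices by truncation.\<close>
    define pt where "pt c p = shift (iv (f p \<cdot> c)) (\<lambda>g i. Y p g (trunc m i))" for c p
    \<comment> \<open>\<open>Rn\<close> writes all patterns around the new net points;
      \<open>Ro\<close> preserves the given configurations on the \<open>v\<close>-balls of the kept
      ones.\<close>
    define Rn where "Rn = {(w, y). \<exists>c\<in>D - D1. \<exists>p\<in>P ` W. y = pt c p \<and> dst w (f p \<cdot> c) \<le> m}"
    define Ro where "Ro = {(w, y). \<exists>b c. (b, y) \<in> R \<and> dst b c \<le> 2 * q \<and> c \<in> N y \<and> dst w c \<le> v}"
    have ptW: "pt c p \<in> W" if "p \<in> P ` W" for c p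
      using admissible Y(1)[OF that] by (simp add: pt_def admissible_def)
    have old: "\<exists>b. (b, y) \<in> R \<and> dst b w \<le> 2 * q + v" if "(w, y) \<in> R \<union> Ro" for w y
    proof (cases "(w, y) \<in> R")
      case True
      then show ?thesis by (intro exI[of _ w]) simp
    next
      case False
      with that obtain b c where "(b, y) \<in> R" "dst b c \<le> 2 * q" "dst w c \<le> v" by (auto simp: Ro_def)
      then show ?thesis using dst_tri[of b w c] dst_sym[of c w] by (intro exI[of _ b]) simp
    qed
    have near: "dst w c \<le> v" if "p \<in> P ` W" "dst w (f p \<cdot> c) \<le> m" for w c p
    proof -
      have "f p \<in> S" using that(1) by (simp add: S_def)
      from s0[OF this] show ?thesis
        using dst_tri[of w c "f p \<cdot> c"] that(2) by (simp add: v_def dst_mul_left)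
    qed
    \<comment> \<open>\<open>oo\<close>, \<open>on\<close> and \<open>nn\<close> handle
      prescriptions within \<open>d\<close> of each other: old ones agree by the hypothesis on
      \<open>R\<close>, an old and a new one are never that close, and new ones agree by separation
      of \<open>D\<close> and \<open>D0\<close>.\<close>
    have oo: "y = y'" if yy: "(w, y) \<in> R \<union> Ro" "(w', y') \<in> R \<union> Ro" "dst w w' \<le> d" for w y w' y'
    proof -
      from old[OF yy(1)] obtain b where b: "(b, y) \<in> R" "dst b w \<le> 2 * q + v" by blast
      from old[OF yy(2)] obtain b' where b': "(b', y') \<in> R" "dst b' w' \<le> 2 * q + v" by blast
      have "dst b b' \<le> 5 * q"
        using dst_tri[of b b' w] dst_tri[of w b' w'] dst_sym[of w' b'] b(2) b'(2) yy(3)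
        by (simp add: q_def)
      then show ?thesis using RcD b(1) b'(1) by blast
    qed
    have on: False if yy: "(w, y) \<in> R \<union> Ro" "(w', y') \<in> Rn" "dst w w' \<le> d" for w y w' y'
    proof -
      from yy(2) obtain c' p where c': "c' \<in> D - D1" "p \<in> P ` W" "dst w' (f p \<cdot> c') \<le> m"
        by (auto simp: Rn_def)
      have w': "dst w' c' \<le> v" using near c'(2,3) by blast
      show False
      proof (cases "(w, y) \<in> R")
        case True
        from new[OF c'(1) True] show False
          using dst_tri[of w c' w'] w' yy(3) by (simp add: q_def)
      next
        case False
        with yy(1) obtain b c where bc: "(b, y) \<in> R" "dst b c \<le> 2 * q" "c \<in> N y" "dst w c \<le> v"
          by (auto simp: Ro_def)
        then have c: "c \<in> D1" by (auto simp: D1_def)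
        have "dst c c' \<le> q"
          using dst_tri[of c c' w] dst_tri[of w c' w'] dst_sym[of c w] bc(4) yy(3) w'
          by (simp add: q_def)
        with Dsep c D(1) c'(1) show False by blast
      qed
    qed
    have nn: "y = y'" if yy: "(w, y) \<in> Rn" "(w', y') \<in> Rn" "dst w w' \<le> d" for w y w' y'
    proof -
      from yy(1) obtain c p where c: "c \<in> D" "p \<in> P ` W" "dst w (f p \<cdot> c) \<le> m" "y = pt c p"
        by (auto simp: Rn_def)
      from yy(2) obtain c' p' where c': "c' \<in> D" "p' \<in> P ` W" "dst w' (f p' \<cdot> c') \<le> m" "y' = pt c' p'"
        by (auto simp: Rn_def)
      have "dst c c' \<le> q"
        using dst_tri[of c c' w] dst_tri[of w c' w'] dst_sym[of c w] yy(3)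
          near[OF c(2,3)] near[OF c'(2,3)] by (simp add: q_def)
      then have cc: "c' = c" using Dsep c(1) c'(1) by blast
      have "dst (f p \<cdot> c) (f p' \<cdot> c) \<le> 2 * m + d"
        using dst_tri[of "f p \<cdot> c" "f p' \<cdot> c" w] dst_tri[of w "f p' \<cdot> c" w'] dst_sym[of w "f p \<cdot> c"]
          yy(3) c(3) c'(3) cc by simp
      moreover have "f p \<in> D0" "f p' \<in> D0" using f(2) c(2) c'(2) by auto
      ultimately have "f p = f p'" using D0 by (simp add: net_def separated_def)
      then have "p = p'" using f(1) c(2) c'(2) by (auto simp: inj_on_def)
      then show ?thesis using c(4) c'(4) cc by simp
    qed
    define R' where "R' = R \<union> Ro \<union> Rn"
    have "\<forall>(b, y)\<in>R'. y \<in> W" using RWD ptW by (auto simp: R'_def Ro_def Rn_def W'_def)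
    moreover have "y = y'" if yy: "(w, y) \<in> R'" "(w', y') \<in> R'" "dst w w' \<le> d" for w y w' y'
    proof -
      have "dst w' w \<le> d" using yy(3) by (simp add: dst_sym)
      then show ?thesis
        using oo[of w y w' y'] on[of w y w' y'] on[of w' y' w y] nn[of w y w' y'] yy
        unfolding R'_def Un_iff by metis
    qed
    then have "\<forall>(b, y)\<in>R'. \<forall>(b', y')\<in>R'. dst b b' \<le> d \<longrightarrow> y = y'" by blast
    ultimately obtain z where z: "z \<in> W" "\<forall>(b, y)\<in>R'. z b = y b"
      using glue[unfolded gluing_def, rule_format, of R'] by blast
    have zD: "z b = y b" if "(b, y) \<in> R'" for b y using bspec[OF z(2) that] by simp
    have "shows_patterns m W ((\<lambda>s. s \<cdot> c) ` S) z" if c: "c \<in> D" for c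
    proof (cases "c \<in> D1")
      case True
      then obtain b y where bb: "(b, y) \<in> R" "dst b c \<le> 2 * q" "c \<in> N y" by (auto simp: D1_def)
      have "ok (N y) y" by (rule N[OF RWD[OF bb(1)]])
      then have "shows_patterns m W ((\<lambda>s. s \<cdot> c) ` S) y" using bb(3) by (simp add: ok_def)
      then show ?thesis
      proof (rule shows_patterns_cong)
        fix g h assume "h \<in> (\<lambda>s. s \<cdot> c) ` S" and g: "dst g e \<le> m"
        then obtain s where s: "s \<in> S" "h = s \<cdot> c" by blast
        have "dst (g \<cdot> h) c \<le> v"
          using dst_tri[of "g \<cdot> h" c h] s0[OF s(1)] g by (simp add: v_def s(2) dst_mul_left)
        with bb have "(g \<cdot> h, y) \<in> R'" by (auto simp: R'_def Ro_def)
        then show "z (g \<cdot> h) = y (g \<cdot> h)" by (rule zD)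
      qed
    next
      case False
      show ?thesis
        unfolding shows_patterns_def
      proof (intro ballI allI impI)
        fix y J assume y: "y \<in> W" and J: "inj_on (trunc m) J"
        from J obtain t where t: "\<And>i. trunc m (t i) = trunc m i" "\<And>i. i \<in> J \<Longrightarrow> t (trunc m i) = i"
          using trunc_section by blast
        \<comment> \<open>For \<open>i \<in> J\<close> the value of \<open>?y\<close> at
          \<open>trunc m i\<close> is that of \<open>y\<close> at \<open>i\<close>, so a copy of its
          standard-window pattern displays \<open>y\<close> on \<open>J\<close>.\<close>
        let ?y = "\<lambda>g i. y g (t i)"
        define p where "p = P ?y"
        have "?y \<in> W" using admissible y t(1) by (simp add: admissible_def)
        then have p: "p \<in> P ` W" by (simp add: p_def)
        have "z (g \<cdot> (f p \<cdot> c)) i = y g i" if g: "dst g e \<le> m" and i: "i \<in> J" for g i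
        proof -
          have "dst (g \<cdot> (f p \<cdot> c)) (f p \<cdot> c) \<le> m" using g by (simp add: dst_mul_left)
          then have "(g \<cdot> (f p \<cdot> c), pt c p) \<in> R'"
            unfolding R'_def Rn_def using c False p by blast
          from zD[OF this] have "z (g \<cdot> (f p \<cdot> c)) i = Y p g (trunc m i)"
            by (simp add: pt_def shift_def)
          also have "\<dots> \<longleftrightarrow> (g, trunc m i) \<in> P (Y p)" using g by (simp add: P_def)
          also have "\<dots> \<longleftrightarrow> (g, trunc m i) \<in> P ?y" using Y(2)[OF p] by (simp add: p_def)
          also have "\<dots> \<longleftrightarrow> y g i" using g t(2)[OF i] by (simp add: P_def)
          finally show ?thesis .
        qed
        then show "\<exists>h\<in>(\<lambda>s. s \<cdot> c) ` S. \<forall>g i. dst g e \<le> m \<longrightarrow> i \<in> J \<longrightarrow> z (g \<cdot> h) i = y g i"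
          using p by (intro bexI[of _ "f p \<cdot> c"]) (auto simp: S_def)
      qed
    qed
    then have "ok D z" using D(2) by (simp add: ok_def)
    then have "z \<in> W'" using z(1) by (auto simp: W'_def)
    moreover have "\<forall>(b, y)\<in>R. z b = y b" using zD by (auto simp: R'_def)
    ultimately show "\<exists>z\<in>W'. \<forall>(b, y)\<in>R. z b = y b" by blast
  qed
  then have "admissible (Suc m) W'" using sh fl ri unfolding admissible_def by blast
  moreover have "W' \<subseteq> W" by (auto simp: W'_def)
  moreover have "finite H" using finite_ball by (simp add: H_def)
  ultimately show thesis using pat by (intro that)
qed

end

section \<open>The topology of configurations\<close>

definition config_top :: "'a config topology" where
  "config_top = product_topology (\<lambda>g. product_topology (\<lambda>i. discrete_topology UNIV) UNIV) UNIV"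

lemma topspace_config_top [simp]: "topspace config_top = UNIV"
  by (simp add: config_top_def)

lemma compact_config_top: "compact_space config_top"
  unfolding config_top_def by (simp add: compact_space_product_topology compact_space_discrete_topology)

lemma Hausdorff_config_top: "Hausdorff_space config_top"
  unfolding config_top_def by (simp add: Hausdorff_space_product_topology)

lemma continuous_map_config:
  "continuous_map X config_top f \<longleftrightarrow> (\<forall>g i. continuous_map X (discrete_topology UNIV) (\<lambda>x. f x g i))"
  unfolding config_top_def by (simp add: continuous_map_componentwise_UNIV)

lemma config_coordinate:
  fixes g :: 'a
  shows "continuous_map config_top (discrete_topology UNIV) (\<lambda>x. x g i)"
proof -
  have "continuous_map config_top config_top (\<lambda>x :: 'a config. x)" by simp
  then show ?thesis unfolding continuous_map_config by blast
qed

lemma openin_cylinder: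
  fixes z :: "'a config"
  assumes "finite A" "finite J"
  shows "openin config_top {x. \<forall>g\<in>A. \<forall>i\<in>J. x g i = z g i}"
proof -
  have "openin config_top {x. x g i = z g i}" for g i
    using openin_continuous_map_preimage[OF config_coordinate, of "{z g i}" g i] by simp
  then have "openin config_top ((\<Inter>p\<in>A \<times> J. {x. x (fst p) (snd p) = z (fst p) (snd p)}) \<inter> topspace config_top)"
    using assms by (intro openin_INT) auto
  moreover have "{x. \<forall>g\<in>A. \<forall>i\<in>J. x g i = z g i} =
      (\<Inter>p\<in>A \<times> J. {x. x (fst p) (snd p) = z (fst p) (snd p)}) \<inter> topspace config_top" by auto
  ultimately show ?thesis by simp
qed

lemma openin_contains_cylinder:
  assumes "openin config_top U" "z \<in> U"
  obtains A J where "finite A" "finite J" "{x. \<forall>g\<in>A. \<forall>i\<in>J. x g i = z g i} \<subseteq> U"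
proof -
  obtain V where V: "finite {g. V g \<noteq> UNIV}" "\<And>g. openin (product_topology (\<lambda>i. discrete_topology UNIV) UNIV) (V g)"
    "z \<in> Pi\<^sub>E UNIV V" "Pi\<^sub>E UNIV V \<subseteq> U"
    using assms unfolding config_top_def openin_product_topology_alt by auto
  have "\<forall>g. \<exists>J. finite J \<and> {y. \<forall>i\<in>J. y i = z g i} \<subseteq> V g"
  proof
    fix g
    have "z g \<in> V g" using V(3) by auto
    with V(2)[of g] obtain T where T: "finite {i. T i \<noteq> UNIV}" "z g \<in> Pi\<^sub>E UNIV T" "Pi\<^sub>E UNIV T \<subseteq> V g"
      unfolding openin_product_topology_alt by auto
    have "{y. \<forall>i\<in>{i. T i \<noteq> UNIV}. y i = z g i} \<subseteq> Pi\<^sub>E UNIV T"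
    proof
      fix y assume y: "y \<in> {y. \<forall>i\<in>{i. T i \<noteq> UNIV}. y i = z g i}"
      have "y i \<in> T i" for i using y T(2) by (cases "T i = UNIV") (auto simp: PiE_UNIV_domain)
      then show "y \<in> Pi\<^sub>E UNIV T" by auto
    qed
    with T(1,3) show "\<exists>J. finite J \<and> {y. \<forall>i\<in>J. y i = z g i} \<subseteq> V g"
      by (intro exI[of _ "{i. T i \<noteq> UNIV}"]) auto
  qed
  from choice[OF this] obtain J where J: "\<And>g. finite (J g)" "\<And>g. {y. \<forall>i\<in>J g. y i = z g i} \<subseteq> V g"
    by auto
  let ?A = "{g. V g \<noteq> UNIV}"
  have "{x. \<forall>g\<in>?A. \<forall>i\<in>\<Union>(J ` ?A). x g i = z g i} \<subseteq> Pi\<^sub>E UNIV V"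
  proof
    fix x assume x: "x \<in> {x. \<forall>g\<in>?A. \<forall>i\<in>\<Union>(J ` ?A). x g i = z g i}"
    have "x g \<in> V g" for g
    proof (cases "V g = UNIV")
      case False
      then have "\<forall>i\<in>J g. x g i = z g i" using x by auto
      then show ?thesis using J(2) by auto
    qed simp
    then show "x \<in> Pi\<^sub>E UNIV V" by auto
  qed
  with V J(1) show thesis by (intro that[of ?A "\<Union>(J ` ?A)"]) auto
qed

lemma closure_of_cylinder:
  assumes "z \<in> config_top closure_of W" "finite A" "finite J"
  obtains x where "x \<in> W" "\<And>g i. g \<in> A \<Longrightarrow> i \<in> J \<Longrightarrow> x g i = z g i"
proof -
  have "z \<in> {x. \<forall>g\<in>A. \<forall>i\<in>J. x g i = z g i}" by simp
  with assms(1) openin_cylinder[OF assms(2,3), of z] obtain x where "x \<in> W" "x \<in> {x. \<forall>g\<in>A. \<forall>i\<in>J. x g i = z g i}"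
    unfolding in_closure_of by meson
  then show thesis by (intro that[of x]) auto
qed

lemma continuous_map_flip: "continuous_map config_top config_top (flip k)"
  unfolding continuous_map_config flip_def
proof (intro allI)
  fix g i
  have "continuous_map config_top (discrete_topology UNIV) ((\<lambda>b. b \<noteq> k i) \<circ> (\<lambda>x. x g i))"
    by (rule continuous_map_compose[OF config_coordinate]) simp
  then show "continuous_map config_top (discrete_topology UNIV) (\<lambda>x. x g i \<noteq> k i)" by (simp add: o_def)
qed

text \<open>Distinct sets of naturals differ at some number, and their truncations beyond it stay
  distinct. So a basic open set only sees indices that every late enough stage controls.\<close>

lemma trunc_separates:
  assumes "finite J"
  shows "\<exists>m0. \<forall>m\<ge>m0. inj_on (trunc m) J"
proof -
  have "\<exists>n. \<forall>m\<ge>n. trunc m i = trunc m j \<longrightarrow> i = j" for i j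
  proof (cases "i = j")
    case False
    then obtain a where a: "a \<in> i \<longleftrightarrow> a \<notin> j" by blast
    have "trunc m i \<noteq> trunc m j" if "m \<ge> Suc a" for m
    proof
      assume "trunc m i = trunc m j"
      then have "a \<in> trunc m i \<longleftrightarrow> a \<in> trunc m j" by simp
      with a that show False by (simp add: trunc_def)
    qed
    then show ?thesis by blast
  qed simp
  then obtain n where n: "\<And>i j m. m \<ge> n i j \<Longrightarrow> trunc m i = trunc m j \<Longrightarrow> i = j" by metis
  have "finite ((\<lambda>(i, j). n i j) ` (J \<times> J))" using assms by simp
  then obtain m0 where m0: "\<forall>k\<in>(\<lambda>(i, j). n i j) ` (J \<times> J). k \<le> m0"
    unfolding finite_nat_set_iff_bounded_le by blast
  have "inj_on (trunc m) J" if "m \<ge> m0" for m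
  proof (rule inj_onI)
    fix i j assume ij: "i \<in> J" "j \<in> J" "trunc m i = trunc m j"
    then have "n i j \<le> m0" using m0 by auto
    with that n ij(3) show "i = j" by (meson le_trans)
  qed
  then show ?thesis by blast
qed

context proper_metric_group
begin

section \<open>Construction of the minimal subshift\<close>

lemma continuous_map_shift: "continuous_map config_top config_top (shift h)"
  unfolding continuous_map_config shift_def by (simp add: config_coordinate)

lemma admissible_sequence:
  obtains W where "\<And>m. admissible m (W m)" "\<And>m. W (Suc m) \<subseteq> W m"
    "\<And>m. \<exists>H. finite H \<and> (\<forall>x\<in>W (Suc m). shows_patterns m (W m) H x)"
proof -
  have "\<exists>W. \<forall>m. admissible m (W m) \<and> (W (Suc m) \<subseteq> W m \<and>
      (\<exists>H. finite H \<and> (\<forall>x\<in>W (Suc m). shows_patterns m (W m) H x)))"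
  proof (rule dependent_nat_choice)
    show "\<exists>x. admissible 0 x" using admissible_UNIV by blast
    fix V n assume "admissible n V"
    then obtain W' H where "admissible (Suc n) W'" "W' \<subseteq> V" "finite H"
      "\<And>x. x \<in> W' \<Longrightarrow> shows_patterns n V H x"
      using admissible_refine[of n V] by metis
    then show "\<exists>y. admissible (Suc n) y \<and> y \<subseteq> V \<and> (\<exists>H. finite H \<and> (\<forall>x\<in>y. shows_patterns n V H x))" by blast
  qed
  then show thesis using that by blast
qed

text \<open>Admissibility includes no closedness, so \<open>Z\<close> is the intersection of the
  closures; compactness makes it nonempty. Minimality holds because every orbit in \<open>Z\<close>
  comes into each cylinder around each point of \<open>Z\<close>.\<close>

proposition flip_invariant_minimal_subshift:
  obtains Z where "Z \<noteq> {}" "closedin config_top Z"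
    "\<And>h. shift h ` Z \<subseteq> Z" "\<And>k. flip k ` Z \<subseteq> Z"
    "\<And>S. closedin config_top S \<Longrightarrow> S \<noteq> {} \<Longrightarrow> S \<subseteq> Z \<Longrightarrow> (\<And>h. shift h ` S \<subseteq> S) \<Longrightarrow> S = Z"
proof -
  obtain W where admissible: "\<And>m. admissible m (W m)" and sub: "\<And>m. W (Suc m) \<subseteq> W m"
    and pat: "\<And>m. \<exists>H. finite H \<and> (\<forall>x\<in>W (Suc m). shows_patterns m (W m) H x)"
    by (rule admissible_sequence) blast
  define C where "C m = config_top closure_of (W m)" for m
  define Z where "Z = (\<Inter>m. C m)"
  \<comment> \<open>Gluing an empty prescription already produces an element.\<close>
  have "W m \<noteq> {}" for m
  proof -
    obtain d where "gluing d (W m)" using admissible[of m] by (auto simp: admissible_def)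
    from this[unfolded gluing_def, rule_format, of "{}"] show ?thesis by auto
  qed
  then have "C m \<noteq> {}" for m
    unfolding C_def using closure_of_subset[of "W m" config_top] by auto
  moreover have "decseq C"
    unfolding C_def by (rule decseq_SucI) (rule closure_of_mono[OF sub])
  ultimately have ne: "Z \<noteq> {}"
    unfolding Z_def using compact_space_imp_nest[OF compact_config_top, of C] by (simp add: C_def)
  have cl: "closedin config_top Z"
    unfolding Z_def C_def by (rule closedin_Inter) auto
  have inv: "f ` Z \<subseteq> Z" if f: "continuous_map config_top config_top f" and "\<And>m. f ` W m \<subseteq> W m" for f
  proof -
    have "f ` C m \<subseteq> C m" for m
      unfolding C_def using continuous_map_image_closure_subset[OF f, of "W m"] closure_of_mono[OF that(2)]
      by blast
    then show ?thesis unfolding Z_def by blast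
  qed
  have sh: "shift h ` Z \<subseteq> Z" for h
    by (rule inv[OF continuous_map_shift]) (use admissible in \<open>auto simp: admissible_def\<close>)
  have fl: "flip k ` Z \<subseteq> Z" for k
    by (rule inv[OF continuous_map_flip]) (use admissible in \<open>auto simp: admissible_def\<close>)
  have "S = Z" if S: "closedin config_top S" "S \<noteq> {}" "S \<subseteq> Z" "\<And>h. shift h ` S \<subseteq> S" for S
  proof -
    obtain z where z: "z \<in> S" using S(2) by blast
    have "z' \<in> S" if z': "z' \<in> Z" for z'
    proof -
      have "z' \<in> config_top closure_of S"
        unfolding in_closure_of
      proof (intro conjI allI impI)
        fix U assume "z' \<in> U \<and> openin config_top U"
        then obtain A J where AJ: "finite A" "finite J" "{x. \<forall>g\<in>A. \<forall>i\<in>J. x g i = z' g i} \<subseteq> U"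
          using openin_contains_cylinder by blast
        obtain m0 where m0: "\<And>m. m \<ge> m0 \<Longrightarrow> inj_on (trunc m) J" using trunc_separates[OF AJ(2)] by blast
        have "finite ((\<lambda>g. dst g e) ` A)" using AJ(1) by simp
        then obtain m1 where m1: "\<forall>k\<in>(\<lambda>g. dst g e) ` A. k \<le> m1"
          unfolding finite_nat_set_iff_bounded_le by blast
        \<comment> \<open>At this stage the ball of radius \<open>m\<close> contains
          \<open>A\<close> and truncation separates \<open>J\<close>, so the restriction of
          \<open>z'\<close> to \<open>A\<close> and \<open>J\<close> is part of a pattern of
          \<open>W m\<close>.\<close>
        define m where "m = max m0 m1"
        have J: "inj_on (trunc m) J" using m0 by (simp add: m_def)
        have A: "dst g e \<le> m" if "g \<in> A" for g using m1 that by (auto simp: m_def intro: le_trans)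
        obtain H where H: "finite H" "\<And>x. x \<in> W (Suc m) \<Longrightarrow> shows_patterns m (W m) H x"
          using pat[of m] by blast
        have "z' \<in> config_top closure_of (W m)" using z' by (auto simp: Z_def C_def)
        then obtain y where y: "y \<in> W m" "\<And>g i. g \<in> A \<Longrightarrow> i \<in> J \<Longrightarrow> y g i = z' g i"
          using closure_of_cylinder AJ(1,2) by blast
        have "z \<in> config_top closure_of (W (Suc m))" using z S(3) by (auto simp: Z_def C_def)
        \<comment> \<open>The place \<open>h\<close> depends on \<open>x\<close>, so
          \<open>x\<close> has to agree with \<open>z\<close> on all translates of \<open>A\<close>
          by \<open>H\<close>; finiteness of \<open>H\<close> makes this a cylinder
          condition.\<close>
        moreover have "finite ((\<lambda>(g, h). g \<cdot> h) ` (A \<times> H))" using AJ(1) H(1) by simp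
        ultimately obtain x where x: "x \<in> W (Suc m)"
          "\<And>g i. g \<in> (\<lambda>(g, h). g \<cdot> h) ` (A \<times> H) \<Longrightarrow> i \<in> J \<Longrightarrow> x g i = z g i"
          using closure_of_cylinder AJ(2) by blast
        from H(2)[OF x(1), unfolded shows_patterns_def, rule_format, OF y(1) J]
        obtain h where h: "h \<in> H" "\<And>g i. dst g e \<le> m \<Longrightarrow> i \<in> J \<Longrightarrow> x (g \<cdot> h) i = y g i" by auto
        have "shift h z g i = z' g i" if "g \<in> A" "i \<in> J" for g i
        proof -
          have "g \<cdot> h \<in> (\<lambda>(g, h). g \<cdot> h) ` (A \<times> H)" using that(1) h(1) by auto
          from x(2)[OF this that(2)] show ?thesis
            using h(2)[OF A[OF that(1)] that(2)] y(2)[OF that] by (simp add: shift_def)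
        qed
        then have "shift h z \<in> U" using AJ(3) by blast
        moreover have "shift h z \<in> S" using S(4)[of h] z by blast
        ultimately show "\<exists>y. y \<in> S \<and> y \<in> U" by blast
      qed simp
      then show ?thesis using S(1) by (simp add: closure_of_closedin)
    qed
    then show ?thesis using S(3) by blast
  qed
  then show thesis using that ne cl sh fl by blast
qed

end

section \<open>Automorphisms of the universal minimal flow\<close>

text \<open>A word metric with every group element as a generator, weighted through the enumeration
  so that only finitely many have bounded weight. \<open>dst g h\<close> is the least weight of a
  word for \<open>h \<cdot> iv g\<close>, whence right invariance.\<close>

lemma word_metric_exists:
  fixes mul :: "'a :: countable \<Rightarrow> 'a \<Rightarrow> 'a" (infixl "\<cdot>" 70)
  assumes assoc: "\<And>g h k. (g \<cdot> h) \<cdot> k = g \<cdot> (h \<cdot> k)"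
    and unit: "\<And>g. e \<cdot> g = g" "\<And>g. g \<cdot> e = g"
    and inv: "\<And>g. iv g \<cdot> g = e" "\<And>g. g \<cdot> iv g = e"
    and inf: "infinite (UNIV :: 'a set)"
  obtains dst where "proper_metric_group mul e iv dst"
proof -
  have inv_uniq: "h = iv g" if "h \<cdot> g = e" for g h
    using that assoc[of h g "iv g"] by (simp add: unit inv)
  have iv_iv: "iv (iv g) = g" for g using inv_uniq[of g "iv g"] inv by simp
  have iv_mul: "iv (g \<cdot> h) = iv h \<cdot> iv g" for g h
  proof -
    have "(iv h \<cdot> iv g) \<cdot> (g \<cdot> h) = iv h \<cdot> ((iv g \<cdot> g) \<cdot> h)" by (simp only: assoc)
    then show ?thesis using inv_uniq[of "iv h \<cdot> iv g" "g \<cdot> h"] by (simp add: unit inv)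
  qed
  have iv_e: "iv e = e" using inv_uniq[of e e] unit by simp
  \<comment> \<open>The minimum gives inverses equal weight; \<open>Suc\<close> makes weights
    positive, so that weight bounds word length and balls are finite.\<close>
  define w where "w g = Suc (min (to_nat g) (to_nat (iv g)))" for g
  have w_iv: "w (iv g) = w g" for g by (simp add: w_def iv_iv min.commute)
  define wt where "wt l = sum_list (map w l)" for l
  define pr where "pr l = foldr mul l e" for l
  have pr_append: "pr (l @ l') = pr l \<cdot> pr l'" for l l'
    by (induction l) (simp_all add: pr_def unit assoc)
  have pr_inv: "pr (rev (map iv l)) = iv (pr l)" for l
  proof (induction l)
    case Nil
    then show ?case by (simp add: pr_def iv_e)
  next
    case (Cons g l)
    have "pr (rev (map iv (g # l))) = pr (rev (map iv l)) \<cdot> pr [iv g]" by (simp add: pr_append)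
    with Cons show ?case by (simp add: pr_def iv_mul unit)
  qed
  have wt_inv: "wt (rev (map iv l)) = wt l" for l
    by (simp add: wt_def rev_map[symmetric] o_def w_iv)
  define dst where "dst g h = (LEAST n. \<exists>l. pr l \<cdot> g = h \<and> wt l = n)" for g h
  have dst_le: "dst g h \<le> wt l" if "pr l \<cdot> g = h" for g h l
    unfolding dst_def by (rule Least_le) (use that in blast)
  have dst_ex: "\<exists>l. pr l \<cdot> g = h \<and> wt l = dst g h" for g h
  proof -
    have "pr [h \<cdot> iv g] \<cdot> g = h" by (simp add: pr_def unit assoc inv)
    then have "\<exists>n. \<exists>l. pr l \<cdot> g = h \<and> wt l = n" by blast
    from LeastI_ex[OF this] show ?thesis by (simp only: dst_def)
  qed
  have sym_le: "dst h g \<le> dst g h" for g h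
  proof -
    obtain l where l: "pr l \<cdot> g = h" "wt l = dst g h" using dst_ex by blast
    have "pr (rev (map iv l)) \<cdot> h = g"
      by (simp add: pr_inv l(1)[symmetric] assoc[symmetric] inv unit)
    from dst_le[OF this] show ?thesis by (simp add: wt_inv l(2))
  qed
  have tri: "dst g k \<le> dst g h + dst h k" for g h k
  proof -
    obtain l where l: "pr l \<cdot> g = h" "wt l = dst g h" using dst_ex by blast
    obtain l' where l': "pr l' \<cdot> h = k" "wt l' = dst h k" using dst_ex by blast
    have "pr (l' @ l) \<cdot> g = k" using l(1) l'(1) by (simp add: pr_append assoc)
    from dst_le[OF this] show ?thesis using l(2) l'(2) by (simp add: wt_def)
  qed
  have cancel: "g \<cdot> k = h \<cdot> k \<longleftrightarrow> g = h" for g h k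
  proof
    assume "g \<cdot> k = h \<cdot> k"
    then have "(g \<cdot> k) \<cdot> iv k = (h \<cdot> k) \<cdot> iv k" by simp
    then show "g = h" by (simp add: assoc inv unit)
  qed simp
  have right_inv: "dst (g \<cdot> k) (h \<cdot> k) = dst g h" for g h k
    unfolding dst_def by (simp add: assoc[symmetric] cancel)
  have fin: "finite {h. dst g h \<le> n}" for g n
  proof -
    have "finite {x :: 'a. to_nat x \<le> n}"
      using finite_vimageI[of "{..n}" "to_nat :: 'a \<Rightarrow> nat"] by (simp add: vimage_def)
    moreover have "finite {x. to_nat (iv x) \<le> n}"
      using finite_vimageI[of "{..n}" "to_nat \<circ> iv"] iv_iv
      by (simp add: vimage_def inj_def) metis
    ultimately have "finite ({x. to_nat x \<le> n} \<union> {x. to_nat (iv x) \<le> n})" by simp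
    moreover have "{x. w x \<le> n} \<subseteq> {x. to_nat x \<le> n} \<union> {x. to_nat (iv x) \<le> n}"
      by (auto simp: w_def)
    ultimately have fw: "finite {x. w x \<le> n}" by (meson finite_subset)
    have "{h. dst g h \<le> n} \<subseteq> (\<lambda>l. pr l \<cdot> g) ` {l. set l \<subseteq> {x. w x \<le> n} \<and> length l \<le> n}"
    proof
      fix h assume "h \<in> {h. dst g h \<le> n}"
      then obtain l where l: "pr l \<cdot> g = h" "wt l \<le> n" using dst_ex[of g h] by auto
      have "w x \<le> wt l" if "x \<in> set l" for x
        unfolding wt_def using that by (intro member_le_sum_list) auto
      moreover have "length l \<le> wt l" unfolding wt_def by (induction l) (auto simp: w_def)
      ultimately have "l \<in> {l. set l \<subseteq> {x. w x \<le> n} \<and> length l \<le> n}" using l(2) by force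
      then show "h \<in> (\<lambda>l. pr l \<cdot> g) ` {l. set l \<subseteq> {x. w x \<le> n} \<and> length l \<le> n}" using l(1) by blast
    qed
    then show ?thesis using finite_lists_length_le[OF fw] by (meson finite_imageI finite_subset)
  qed
  have "dst g g = 0" for g using dst_le[of "[]" g g] by (simp add: pr_def unit wt_def)
  then have "proper_metric_group mul e iv dst"
    by unfold_locales (use assoc unit inv sym_le tri right_inv fin inf in \<open>auto intro: antisym\<close>)
  then show thesis by (rule that)
qed

text \<open>In the locale the group is a whole type, so \<open>G\<close> is transported to
  \<open>nat\<close> by a bijective enumeration of its carrier.\<close>

lemma flip_commutes_minimal_flow_exists:
  assumes G: "group G" and count: "countable (carrier G)" and inf: "infinite (carrier G)"
  obtains Z :: "nat config topology" and b where "minimal_gflow G Z b" "\<forall>k. flow_hom G Z b Z b (flip k)"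
proof -
  interpret G: group G by (rule G)
  define \<phi> where "\<phi> = to_nat_on (carrier G)"
  define \<psi> where "\<psi> = from_nat_into (carrier G)"
  have \<psi>\<phi>: "\<psi> (\<phi> g) = g" if "g \<in> carrier G" for g
    using that count by (simp add: \<phi>_def \<psi>_def)
  have \<phi>\<psi>: "\<phi> (\<psi> n) = n" for n
    using count inf by (simp add: \<phi>_def \<psi>_def)
  have \<psi>_in: "\<psi> n \<in> carrier G" for n
    using inf by (auto simp: \<psi>_def intro: from_nat_into)
  define mul where "mul m n = \<phi> (\<psi> m \<otimes>\<^bsub>G\<^esub> \<psi> n)" for m n
  define iv where "iv m = \<phi> (inv\<^bsub>G\<^esub> (\<psi> m))" for m
  obtain dst where "proper_metric_group mul (\<phi> \<one>\<^bsub>G\<^esub>) iv dst"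
  proof (rule word_metric_exists[of mul "\<phi> \<one>\<^bsub>G\<^esub>" iv])
    fix g h k
    show "mul (mul g h) k = mul g (mul h k)" by (simp add: mul_def \<psi>\<phi> \<psi>_in G.m_assoc)
    show "mul (\<phi> \<one>\<^bsub>G\<^esub>) g = g" "mul g (\<phi> \<one>\<^bsub>G\<^esub>) = g" by (simp_all add: mul_def \<psi>\<phi> \<psi>_in \<phi>\<psi>)
    show "mul (iv g) g = \<phi> \<one>\<^bsub>G\<^esub>" "mul g (iv g) = \<phi> \<one>\<^bsub>G\<^esub>" by (simp_all add: mul_def iv_def \<psi>\<phi> \<psi>_in)
  qed auto
  then interpret N: proper_metric_group mul "\<phi> \<one>\<^bsub>G\<^esub>" iv dst .
  obtain Z where Z: "Z \<noteq> {}" "closedin config_top Z" "\<And>h. N.shift h ` Z \<subseteq> Z" "\<And>k. flip k ` Z \<subseteq> Z"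
    and min: "\<And>S. closedin config_top S \<Longrightarrow> S \<noteq> {} \<Longrightarrow> S \<subseteq> Z \<Longrightarrow> (\<And>h. N.shift h ` S \<subseteq> S) \<Longrightarrow> S = Z"
    using N.flip_invariant_minimal_subshift by metis
  define b where "b g = N.shift (\<phi> g)" for g
  have "gflow G config_top b"
    unfolding gflow_def
  proof (intro conjI ballI)
    show "continuous_map config_top config_top (b g)" for g
      by (simp add: b_def N.continuous_map_shift)
    show "b \<one>\<^bsub>G\<^esub> x = x" for x by (simp add: b_def N.shift_def)
    show "b (g \<otimes>\<^bsub>G\<^esub> h) x = b g (b h x)" if "g \<in> carrier G" "h \<in> carrier G" for g h x
    proof -
      have "\<phi> (g \<otimes>\<^bsub>G\<^esub> h) = mul (\<phi> g) (\<phi> h)" using that by (simp add: mul_def \<psi>\<phi>)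
      then show ?thesis by (simp add: b_def N.shift_def N.assoc)
    qed
    show "topspace config_top \<noteq> {}" unfolding topspace_config_top by (rule UNIV_not_empty)
  qed (use G in \<open>simp_all add: compact_config_top Hausdorff_config_top\<close>)
  moreover have binv: "\<forall>g\<in>carrier G. b g ` Z \<subseteq> Z" using Z(3) by (simp add: b_def)
  ultimately have flow: "gflow G (subtopology config_top Z) b"
    using gflow_subflow Z(1,2) by blast
  have "S = Z" if S: "closedin (subtopology config_top Z) S" "S \<noteq> {}" "\<forall>g\<in>carrier G. b g ` S \<subseteq> S" for S
  proof (rule min)
    show "closedin config_top S" by (rule closedin_trans_full[OF S(1) Z(2)])
    show "S \<subseteq> Z" using closedin_imp_subset[OF S(1)] by blast
    show "N.shift h ` S \<subseteq> S" for h
      using S(3)[rule_format, OF \<psi>_in[of h]] by (simp add: b_def \<phi>\<psi>)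
  qed (rule S(2))
  then have "minimal_gflow G (subtopology config_top Z) b" using flow by (simp add: minimal_gflow_def)
  moreover have "flow_hom G (subtopology config_top Z) b (subtopology config_top Z) b (flip k)" for k
    using Z(4)[of k] unfolding flow_hom_def continuous_map_in_subtopology
    by (auto simp: continuous_map_from_subtopology continuous_map_flip b_def flip_def N.shift_def)
  ultimately show thesis using that by blast
qed

section \<open>Cardinality of the automorphism group\<close>

lemma lepoll_Pow_mono: "A \<lesssim> B \<Longrightarrow> Pow A \<lesssim> Pow B"
  unfolding lepoll_def using inj_on_image_Pow image_Pow_mono by metis

theorem theorem11p3:
  fixes G :: "('g, 'm) monoid_scheme" and X :: "'x topology" and a :: "'g \<Rightarrow> 'x \<Rightarrow> 'x"
  assumes "group G" and "countable (carrier G)" and "infinite (carrier G)"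
    and "universal_minimal_flow G X a"
  shows "flow_aut G X a \<approx> Pow (UNIV :: real set) \<and> \<not> proximal_flow G X a"
proof -
  have min: "minimal_gflow G X a" using assms(4) by (simp add: universal_minimal_flow_def)
  then have "gflow G X a" by (simp add: minimal_gflow_def)
  then obtain x0 where x0: "x0 \<in> topspace X" by (rule gflow_point)
  obtain Z :: "nat config topology" and b where Z: "minimal_gflow G Z b" "\<forall>k. flow_hom G Z b Z b (flip k)"
    by (rule flip_commutes_minimal_flow_exists[OF assms(1-3)])
  obtain f where f: "flow_hom G X a Z b f" by (rule universal_factor[OF assms(4) Z(1)])
  have "\<forall>k. \<exists>\<phi>. \<phi> \<in> flow_aut G X a \<and> f (\<phi> x0) = flip k (f x0)"
    using universal_lift_automorphism[OF assms(4) Z(1) f Z(2)[rule_format]] x0 by metis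
  then obtain \<Phi> where \<Phi>: "\<And>k. \<Phi> k \<in> flow_aut G X a" "\<And>k. f (\<Phi> k x0) = flip k (f x0)" by metis
  \<comment> \<open>Flips act freely on configurations, so lifts of distinct flips already differ at
    \<open>x0\<close>.\<close>
  have flip_inj: "k = k'" if "flip k z = flip k' z" for k k' and z :: "nat config"
  proof
    fix i
    from that have "flip k z 0 i = flip k' z 0 i" by simp
    then show "k i = k' i" by (auto simp: flip_def)
  qed
  have \<Phi>_inj: "k = k'" if "\<Phi> k = \<Phi> k'" for k k'
    using \<Phi>(2)[of k] \<Phi>(2)[of k'] that by (intro flip_inj[of k "f x0"]) simp
  have "Pow (UNIV :: real set) \<lesssim> Pow (UNIV :: nat set set)"
    by (rule lepoll_Pow_mono[OF eqpoll_imp_lepoll[OF eqpoll_sym[OF nat_sets_eqpoll_reals]]])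
  also have "\<dots> \<lesssim> flow_aut G X a"
    unfolding lepoll_def
  proof (intro exI conjI)
    show "inj_on (\<lambda>A. \<Phi> (\<lambda>i. i \<in> A)) (Pow UNIV)"
    proof (rule inj_onI)
      fix A B assume "\<Phi> (\<lambda>i. i \<in> A) = \<Phi> (\<lambda>i. i \<in> B)"
      from \<Phi>_inj[OF this] show "A = B" by (auto simp: fun_eq_iff)
    qed
    show "(\<lambda>A. \<Phi> (\<lambda>i. i \<in> A)) ` Pow UNIV \<subseteq> flow_aut G X a" using \<Phi>(1) by blast
  qed
  finally have lower: "Pow (UNIV :: real set) \<lesssim> flow_aut G X a" .
  have "flow_aut G X a \<lesssim> topspace X"
    unfolding lepoll_def
  proof (intro exI conjI)
    show "inj_on (\<lambda>\<phi>. \<phi> x0) (flow_aut G X a)"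
      by (rule inj_onI) (rule flow_aut_eqI[OF min _ _ x0])
    show "(\<lambda>\<phi>. \<phi> x0) ` flow_aut G X a \<subseteq> topspace X"
      using x0 by (auto simp: flow_aut_def dest!: homeomorphic_imp_surjective_map)
  qed
  also have "topspace X \<lesssim> Pow (Pow (carrier G))"
    using minimal_gflow_embeds[OF min] unfolding lepoll_def by metis
  also have "Pow (Pow (carrier G)) \<lesssim> Pow (UNIV :: real set)"
  proof (rule lepoll_Pow_mono)
    have "carrier G \<lesssim> (UNIV :: nat set)" using assms(2) by (simp add: countable_def lepoll_def)
    then have "Pow (carrier G) \<lesssim> (UNIV :: nat set set)" using lepoll_Pow_mono by fastforce
    also have "(UNIV :: nat set set) \<approx> (UNIV :: real set)" by (rule nat_sets_eqpoll_reals)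
    finally show "Pow (carrier G) \<lesssim> (UNIV :: real set)" .
  qed
  finally have "flow_aut G X a \<approx> Pow (UNIV :: real set)" using lower lepoll_antisym by blast
  moreover have "\<Phi> (\<lambda>_. True) \<noteq> (\<lambda>x. x)"
  proof
    assume "\<Phi> (\<lambda>_. True) = (\<lambda>x. x)"
    then have "flip (\<lambda>_. True) (f x0) = flip (\<lambda>_. False) (f x0)"
      using \<Phi>(2)[of "\<lambda>_. True"] by (simp add: flip_def)
    from flip_inj[OF this] show False by (simp add: fun_eq_iff)
  qed
  ultimately show ?thesis using not_proximal_if_automorphism[OF min \<Phi>(1)] by blast
qed

end
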